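(* Let $\alpha$ be the parameter of a family of very simple increasing trees, let $D(\mathcal{T}_n)$ be the depth of the centroid (the one nearest to the root) in a random tree of size $n$, and let $\mathcal{D}$ be its limiting random variable (defined in the context). Then the moments of $D(\mathcal{T}_n)$ converge to those of $\mathcal{D}$: for every positive integer $m$, $$\lim_{n\to\infty}E_n(D^m)=E(\mathcal{D}^m).$$
   Context: Random trees. An increasing tree of size $n$ is a rooted tree with $n$ nodes labelled $1,\dots,n$ such that labels increase along every path leading away from the root (so the root has label $1$). A family of very simple increasing trees is given by real constants $c_1>0$ and $c_2$; put $\alpha=1+c_2/c_1>0$. The admissible cases are: $c_2=0$, $\alpha=1$ (general recursive trees); $c_2<0$, $0<\alpha<1$ (general plane-oriented trees); $c_2>0$, $\alpha=d/(d-1)$ with an integer $d\ge2$ (general $d$-ary increasing trees). A plane (i.e. ordered) increasing tree $T$ has weight $\omega(T)=\prod_v\phi_{\mathrm{outdeg}(v)}$, where $\sum_i\phi_iu^i=\phi(u)$ with $\phi(u)=\exp(c_1u)$ if $c_2=0$ and $\phi(u)=(1+c_2u)^{1+c_1/c_2}$ otherwise; a random tree $\mathcal{T}_n$ of size $n$ is drawn with probability proportional to its weight. Equivalently (ignoring the order of children), the random tree is produced by the growth process which starts with the root $1$ and, for $i=2,\dots,n$, attaches node $i$ as a child to an existing node of current out-degree $k$ with probability $\frac{\alpha-(\alpha-1)k}{i+\alpha-2}$. $E_n$ denotes expectation for a random tree of size $n$. Centroid. A centroid of a tree is a node minimising the sum of distances to all other nodes; equivalently, each branch at the node (maximal subtree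 not containing it) contains at most half of the nodes of the tree. Every tree has one centroid or two adjacent centroids; "the centroid" means the one nearest to the root. $D=D(T)$ is the number of edges on the path from the root to the centroid. Limit variable. $\mathcal{D}$ takes values in $\mathbb{Z}_{\ge0}$, with $$P(\mathcal{D}=h)=\frac{\alpha^h}{(\alpha-1)^{h+1}}\left[2^{1-\alpha}\left(\sum_{j=0}^{h-1}\frac{((\alpha-1)\ln 2)^j}{j!}+\frac{\alpha((\alpha-1)\ln 2)^h}{h!}\right)-1\right]$$ for $\alpha\ne1$, and $P(\mathcal{D}=h)=\frac{(\ln2)^h}{h!}-\frac{(\ln2)^{h+1}}{(h+1)!}$ for $\alpha=1$. *)

theory Defs
  imports
    "HOL-Probability.Probability"
    "HOL-Computational_Algebra.Formal_Power_Series"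
begin

section \<open>Plane increasing trees\<close>

text \<open>
  A plane tree on the nodes \<open>1, \<dots>, n\<close> is represented by the function mapping each node to the
  ordered list of its children; numbers that are not nodes are mapped to the empty list, so that
  distinct functions represent distinct trees. Since the label of a child exceeds that of its
  parent, there are no cycles, and uniqueness of the parent of every node other than \<open>1\<close>
  makes the structure a tree rooted at \<open>1\<close>.
\<close>

type_synonym plane_tree = "nat \<Rightarrow> nat list"

definition plane_increasing_trees :: "nat \<Rightarrow> plane_tree set" where
  "plane_increasing_trees n = {T.
     (\<forall>v. v \<notin> {1..n} \<longrightarrow> T v = []) \<and>
     (\<forall>v\<in>{1..n}. distinct (T v) \<and> (\<forall>w\<in>set (T v). v < w \<and> w \<le> n)) \<and>
     (\<forall>w\<in>{2..n}. \<exists>!v. v \<in> {1..n} \<and> w \<in> set (T v))}"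

definition tree_edges :: "plane_tree \<Rightarrow> (nat \<times> nat) set" where
  "tree_edges T = {(v, w). w \<in> set (T v)}"

definition tree_dist :: "plane_tree \<Rightarrow> nat \<Rightarrow> nat \<Rightarrow> nat" where
  "tree_dist T u v = (LEAST k. (u, v) \<in> (tree_edges T \<union> (tree_edges T)\<inverse>) ^^ k)"

definition total_dist :: "nat \<Rightarrow> plane_tree \<Rightarrow> nat \<Rightarrow> nat" where
  "total_dist n T v = (\<Sum>w\<in>{1..n}. tree_dist T v w)"

definition centroids :: "nat \<Rightarrow> plane_tree \<Rightarrow> nat set" where
  "centroids n T = {v. is_arg_min (total_dist n T) (\<lambda>u. u \<in> {1..n}) v}"

definition centroid :: "nat \<Rightarrow> plane_tree \<Rightarrow> nat" where
  "centroid n T = arg_min (tree_dist T 1) (\<lambda>v. v \<in> centroids n T)"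

definition centroid_depth :: "nat \<Rightarrow> plane_tree \<Rightarrow> nat" where
  "centroid_depth n T = tree_dist T 1 (centroid n T)"


section \<open>Very simple families of increasing trees\<close>

definition tree_alpha :: "real \<Rightarrow> real \<Rightarrow> real" where
  "tree_alpha c1 c2 = 1 + c2 / c1"

definition very_simple :: "real \<Rightarrow> real \<Rightarrow> bool" where
  "very_simple c1 c2 \<longleftrightarrow> c1 > 0 \<and> tree_alpha c1 c2 > 0 \<and>
     (c2 = 0 \<or> c2 < 0 \<or>
      (c2 > 0 \<and> (\<exists>d::nat. d \<ge> 2 \<and> tree_alpha c1 c2 = real d / (real d - 1))))"

text \<open>
  The weight generating function is \<open>exp (c1 * u)\<close> if \<open>c2 = 0\<close> and
  \<open>(1 + c2 * u) powr (1 + c1 / c2)\<close> otherwise, as a formal power series in \<open>u\<close>;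
  \<open>fps_binomial a\<close> is the binomial series of \<open>(1 + u) powr a\<close>.
\<close>

definition degree_weights :: "real \<Rightarrow> real \<Rightarrow> real fps" where
  "degree_weights c1 c2 =
     (if c2 = 0 then fps_exp c1
      else fps_compose (fps_binomial (1 + c1 / c2)) (fps_const c2 * fps_X))"

definition tree_weight :: "real \<Rightarrow> real \<Rightarrow> nat \<Rightarrow> plane_tree \<Rightarrow> real" where
  "tree_weight c1 c2 n T = (\<Prod>v\<in>{1..n}. fps_nth (degree_weights c1 c2) (length (T v)))"

definition random_tree :: "real \<Rightarrow> real \<Rightarrow> nat \<Rightarrow> plane_tree pmf" where
  "random_tree c1 c2 n = embed_pmf (\<lambda>T.
     if T \<in> plane_increasing_trees n
     then tree_weight c1 c2 n T / (\<Sum>S\<in>plane_increasing_trees n. tree_weight c1 c2 n S)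
     else 0)"


section \<open>The limit law\<close>

definition limit_prob :: "real \<Rightarrow> nat \<Rightarrow> real" where
  "limit_prob \<alpha> h =
     (if \<alpha> = 1 then (ln 2) ^ h / fact h - (ln 2) ^ (h + 1) / fact (h + 1)
      else \<alpha> ^ h / (\<alpha> - 1) ^ (h + 1) *
        (2 powr (1 - \<alpha>) *
           ((\<Sum>j<h. ((\<alpha> - 1) * ln 2) ^ j / fact j) + \<alpha> * ((\<alpha> - 1) * ln 2) ^ h / fact h) - 1))"

definition limit_depth :: "real \<Rightarrow> nat pmf" where
  "limit_depth \<alpha> = embed_pmf (limit_prob \<alpha>)"


section \<open>The distributions are well defined\<close>

lemma finite_plane_increasing_trees: "finite (plane_increasing_trees n)"
proof -
  let ?L = "{xs. set xs \<subseteq> {1..n} \<and> length xs \<le> n}"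
  have in_L: "T v \<in> ?L" if T: "T \<in> plane_increasing_trees n" and v: "v \<in> {1..n}" for T v
  proof -
    from T v have d: "distinct (T v)" and s: "\<And>w. w \<in> set (T v) \<Longrightarrow> v < w \<and> w \<le> n"
      unfolding plane_increasing_trees_def by blast+
    have sub: "set (T v) \<subseteq> {1..n}" using s v by fastforce
    have "card (set (T v)) \<le> card {1..n}" by (rule card_mono) (use sub in auto)
    then show ?thesis using sub d by (simp add: distinct_card)
  qed
  have nil: "T v = []" if "T \<in> plane_increasing_trees n" "v \<notin> {1..n}" for T v
    using that unfolding plane_increasing_trees_def by blast
  have "plane_increasing_trees n \<subseteq> {T. \<forall>v. (v \<in> {1..n} \<longrightarrow> T v \<in> ?L) \<and> (v \<notin> {1..n} \<longrightarrow> T v = [])}"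
    using in_L nil by blast
  moreover have "finite {T. \<forall>v. (v \<in> {1..n} \<longrightarrow> T v \<in> ?L) \<and> (v \<notin> {1..n} \<longrightarrow> T v = [])}"
    by (rule finite_set_of_finite_funs) (auto intro: finite_lists_length_le)
  ultimately show ?thesis by (rule finite_subset)
qed

lemma degree_weights_nth:
  assumes "c1 > 0"
  shows "fps_nth (degree_weights c1 c2) k =
    c1 ^ k * (\<Prod>j<k. tree_alpha c1 c2 - real j * (tree_alpha c1 c2 - 1)) / fact k"
proof (cases "c2 = 0")
  case True
  then show ?thesis using assms by (simp add: degree_weights_def tree_alpha_def)
next
  case False
  have "c2 ^ k * ((1 + c1 / c2) gchoose k) = c2 ^ k * (\<Prod>j<k. 1 + c1 / c2 - real j) / fact k"
    by (simp add: gbinomial_prod_rev atLeast0LessThan)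
  also have "c2 ^ k * (\<Prod>j<k. 1 + c1 / c2 - real j) = (\<Prod>j<k. c2 * (1 + c1 / c2 - real j))"
    by (simp add: prod.distrib)
  also have "\<dots> = (\<Prod>j<k. c1 * (tree_alpha c1 c2 - real j * (tree_alpha c1 c2 - 1)))"
    using assms False by (intro prod.cong) (auto simp: tree_alpha_def field_simps)
  finally show ?thesis using False
    by (simp add: degree_weights_def fps_nth_compose_linear prod.distrib)
qed

lemma degree_weights_nonneg:
  assumes "very_simple c1 c2"
  shows "fps_nth (degree_weights c1 c2) k \<ge> 0"
proof -
  define a where "a = tree_alpha c1 c2"
  have c1: "c1 > 0" and a: "a > 0" using assms by (auto simp: very_simple_def a_def)
  have "(\<Prod>j<k. a - real j * (a - 1)) \<ge> 0"
  proof (cases "c2 > 0")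
    case False
    have "a - 1 \<le> 0" using False c1 by (auto simp: a_def tree_alpha_def divide_le_0_iff)
    then have "\<And>j. a - real j * (a - 1) \<ge> 0" using a
      by (smt (verit) mult_nonneg_nonpos of_nat_0_le_iff)
    then show ?thesis by (simp add: prod_nonneg)
  next
    case True
    then obtain d :: nat where d: "d \<ge> 2" "a = real d / (real d - 1)"
      using assms by (auto simp: very_simple_def a_def)
    have eq: "a - real j * (a - 1) = (real d - real j) / (real d - 1)" for j
    proof -
      have "a - 1 = 1 / (real d - 1)" using d by (simp add: field_simps)
      then show ?thesis using d by (simp add: diff_divide_distrib)
    qed
    show ?thesis
    proof (cases "k \<le> d")
      case True
      then show ?thesis unfolding eq using d by (intro prod_nonneg) auto
    next
      case False
      then have "(\<Prod>j<k. a - real j * (a - 1)) = 0" unfolding eq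
        by (intro prod_zero) auto
      then show ?thesis by (rule eq_refl[OF sym])
    qed
  qed
  then show ?thesis unfolding degree_weights_nth[OF c1] a_def using c1 by simp
qed

lemma tree_weight_nonneg: "very_simple c1 c2 \<Longrightarrow> tree_weight c1 c2 n T \<ge> 0"
  unfolding tree_weight_def by (intro prod_nonneg) (auto intro: degree_weights_nonneg)

lemma total_weight_pos:
  assumes "very_simple c1 c2"
  shows "(\<Sum>S\<in>plane_increasing_trees n. tree_weight c1 c2 n S) > 0"
proof -
  define T :: plane_tree where "T = (\<lambda>v. if v \<in> {1..<n} then [Suc v] else [])"
  have c: "c1 > 0" "tree_alpha c1 c2 > 0" using assms by (auto simp: very_simple_def)
  have T: "T \<in> plane_increasing_trees n"
    unfolding plane_increasing_trees_def
  proof (intro CollectI conjI ballI allI impI)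
    fix w assume w: "w \<in> {2..n}"
    show "\<exists>!v. v \<in> {1..n} \<and> w \<in> set (T v)"
    proof (rule ex1I[of _ "w - 1"])
      show "w - 1 \<in> {1..n} \<and> w \<in> set (T (w - 1))" using w by (auto simp: T_def)
    next
      fix v assume "v \<in> {1..n} \<and> w \<in> set (T v)"
      then show "v = w - 1" by (auto simp: T_def split: if_splits)
    qed
  qed (auto simp: T_def split: if_splits)
  have "tree_weight c1 c2 n T > 0"
    unfolding tree_weight_def using c by (intro prod_pos) (auto simp: T_def degree_weights_nth)
  then show ?thesis
    using T finite_plane_increasing_trees tree_weight_nonneg[OF assms] by (intro sum_pos2)
qed

lemma pmf_random_tree:
  assumes "very_simple c1 c2"
  shows "pmf (random_tree c1 c2 n) T =
     (if T \<in> plane_increasing_trees n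
      then tree_weight c1 c2 n T / (\<Sum>S\<in>plane_increasing_trees n. tree_weight c1 c2 n S)
      else 0)"
proof -
  let ?A = "plane_increasing_trees n"
  let ?Z = "\<Sum>S\<in>?A. tree_weight c1 c2 n S"
  let ?f = "\<lambda>T. if T \<in> ?A then tree_weight c1 c2 n T / ?Z else 0"
  have nonneg: "?f T \<ge> 0" for T
    using tree_weight_nonneg[OF assms] total_weight_pos[OF assms, of n] by simp
  have "(\<integral>\<^sup>+T. ennreal (?f T) \<partial>count_space UNIV) = (\<Sum>T\<in>?A. ennreal (?f T))"
    by (rule nn_integral_count_space'[OF finite_plane_increasing_trees]) auto
  also have "\<dots> = ennreal (\<Sum>T\<in>?A. ?f T)"
    using nonneg by (intro sum_ennreal) blast
  also have "(\<Sum>T\<in>?A. ?f T) = 1"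
    using total_weight_pos[OF assms, of n] by (simp add: sum_divide_distrib[symmetric])
  finally show ?thesis
    unfolding random_tree_def using nonneg by (subst pmf_embed_pmf) auto
qed


lemma limit_depth_tails:
  fixes \<alpha> :: real
  assumes "0 < \<alpha>" "\<alpha> \<le> 2"
  shows limit_prob_nonneg: "limit_prob \<alpha> h \<ge> 0" and limit_prob_sums: "limit_prob \<alpha> sums 1"
proof -
  define x where "x = (\<alpha> - 1) * ln 2"
  define R where "R k = (\<Sum>i. x ^ i / fact (k + i))" for k
  define q where "q k = \<alpha> ^ k * ln 2 ^ k * exp (- x) * R k" for k
  have fle: "fact k * fact i \<le> (fact (k + i) :: real)" for k i
    using dvd_imp_le[OF fact_fact_dvd_fact[of k i]]
    by (metis fact_gt_zero of_nat_fact of_nat_le_iff of_nat_mult)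
  have le: "norm (x ^ i / fact (k + i)) \<le> \<bar>x\<bar> ^ i / fact i / fact k" for k i
    using fle[of k i] by (simp add: power_abs mult.commute divide_left_mono)
  have es: "(\<lambda>i. \<bar>x\<bar> ^ i / fact i / fact k) sums (exp \<bar>x\<bar> / fact k)" for k
    using sums_divide[OF exp_converges[of "\<bar>x\<bar>"], of "fact k"] by (simp add: divide_inverse mult_ac)
  have summ: "summable (\<lambda>i. x ^ i / fact (k + i))" for k
    by (rule summable_comparison_test'[OF sums_summable[OF es[of k]]]) (rule le)
  have R_bound: "\<bar>R k\<bar> \<le> exp \<bar>x\<bar> / fact k" for k
  proof -
    have "norm (R k) \<le> (\<Sum>i. \<bar>x\<bar> ^ i / fact i / fact k)"
      unfolding R_def by (rule norm_suminf_le) (use le sums_summable[OF es] in auto)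
    then show ?thesis using sums_unique[OF es[of k]] by simp
  qed
  have R_rec: "R k = 1 / fact k + x * R (Suc k)" for k
  proof -
    have "R k = x ^ 0 / fact (k + 0) + (\<Sum>i. x ^ Suc i / fact (k + Suc i))"
      unfolding R_def using suminf_split_head[OF summ[of k]] by simp
    also have "(\<Sum>i. x ^ Suc i / fact (k + Suc i)) = x * R (Suc k)"
      unfolding R_def using suminf_mult[OF summ[of "Suc k"], of x] by simp
    finally show ?thesis by simp
  qed
  have R_0: "R 0 = exp x"
    unfolding R_def exp_def by (simp add: divide_inverse mult.commute)
  have R_part: "x ^ k * R k = exp x - (\<Sum>j<k. x ^ j / fact j)" for k
  proof (induction k)
    case (Suc k)
    then show ?case using R_rec[of k] by (simp add: algebra_simps)
  qed (simp add: R_0)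
  have pq: "limit_prob \<alpha> k = q k - q (Suc k)" for k
  proof (cases "\<alpha> = 1")
    case True
    then have "x = 0" by (simp add: x_def)
    then have "R k = 1 / fact k" for k using R_rec[of k] by simp
    then show ?thesis using True \<open>x = 0\<close> by (simp add: limit_prob_def q_def)
  next
    case False
    define b where "b = \<alpha> - 1"
    have b: "b \<noteq> 0" "\<alpha> = b + 1" "x = b * ln 2" using False by (auto simp: b_def x_def)
    have powr: "2 powr (1 - \<alpha>) = exp (- x)"
      by (simp add: powr_def x_def algebra_simps)
    have R1: "b * ln 2 * R (Suc k) = R k - 1 / fact k" using R_rec[of k] b by simp
    have "limit_prob \<alpha> k = \<alpha> ^ k / b ^ Suc k *
        (exp (- x) * (exp x - x ^ k * R k + \<alpha> * x ^ k / fact k) - 1)"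
      using False R_part[of k] by (simp add: limit_prob_def powr b_def x_def)
    also have "exp (- x) * (exp x - x ^ k * R k + \<alpha> * x ^ k / fact k) - 1 =
        exp (- x) * x ^ k * (\<alpha> / fact k - R k)"
      by (simp add: algebra_simps exp_minus)
    also have "\<alpha> ^ k / b ^ Suc k * (exp (- x) * x ^ k * (\<alpha> / fact k - R k)) =
        \<alpha> ^ k * ln 2 ^ k * exp (- x) * ((\<alpha> / fact k - R k) / b)"
      using b(1) by (simp add: b(3) power_mult_distrib)
    also have "(\<alpha> / fact k - R k) / b = R k - \<alpha> * ln 2 * R (Suc k)"
    proof -
      have "b * (R k - \<alpha> * ln 2 * R (Suc k)) = b * R k - \<alpha> * (b * ln 2 * R (Suc k))"
        by (simp add: algebra_simps)
      also have "\<dots> = \<alpha> / fact k - R k" unfolding R1 b(2) by (simp add: algebra_simps add_divide_distrib)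
      finally show ?thesis using b(1) by (simp add: field_simps)
    qed
    finally show ?thesis by (simp add: q_def algebra_simps)
  qed
  have ln2: "0 < ln (2::real)" "ln (2::real) < 1" using ln_2_less_1 by auto
  have exp_le: "exp (t * ln 2) \<le> 1 + t" if "0 \<le> t" "t \<le> 1" for t :: real
    using convex_onD[OF exp_convex, of t 0 "ln 2"] that by (simp add: algebra_simps)
  have nonneg: "limit_prob \<alpha> k \<ge> 0" for k
  proof -
    have "ln 2 * R (Suc k) \<le> 1 / fact k"
    proof (cases "\<alpha> > 1")
      case True
      then have x: "x > 0" by (simp add: x_def)
      have "exp \<bar>x\<bar> \<le> \<alpha>" using exp_le[of "\<alpha> - 1"] True assms x by (simp add: x_def)
      then have "exp \<bar>x\<bar> / fact k \<le> \<alpha> / fact k" by (intro divide_right_mono) auto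
      then have "1 / fact k + x * R (Suc k) \<le> \<alpha> / fact k"
        using R_bound[of k] R_rec[of k] by linarith
      then have "(\<alpha> - 1) * (ln 2 * R (Suc k)) \<le> (\<alpha> - 1) * (1 / fact k)"
        by (simp add: x_def algebra_simps diff_divide_distrib)
      then show ?thesis using True by (simp only: mult_le_cancel_left_pos)
    next
      case False
      let ?j = "Suc (Suc k)"
      have x: "x \<le> 0" "\<bar>x\<bar> = (1 - \<alpha>) * ln 2"
        using False ln2 by (auto simp: x_def abs_mult mult_nonpos_nonneg)
      have "exp \<bar>x\<bar> \<le> 2" unfolding x(2) using exp_le[of "1 - \<alpha>"] False assms by simp
      moreover have "\<bar>x\<bar> \<le> 1"
        unfolding x(2) using False assms ln2 by (intro mult_le_one) auto
      ultimately have "\<bar>x\<bar> * exp \<bar>x\<bar> \<le> 1 * 2" by (intro mult_mono) auto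
      moreover have "\<bar>x * R (Suc ?j)\<bar> \<le> \<bar>x\<bar> * exp \<bar>x\<bar> / fact (Suc ?j)"
        using mult_left_mono[OF R_bound[of "Suc ?j"], of "\<bar>x\<bar>"] by (simp add: abs_mult)
      moreover have "2 / fact (Suc ?j) \<le> (1 :: real) / fact ?j"
        unfolding fact_Suc[of ?j] by (simp add: divide_simps)
      ultimately have "\<bar>x * R (Suc ?j)\<bar> \<le> 1 / fact ?j"
        by (smt (verit) divide_right_mono fact_ge_zero)
      then have "R ?j \<ge> 0" using R_rec[of ?j] by linarith
      then have "R (Suc k) \<le> 1 / fact (Suc k)"
        using R_rec[of "Suc k"] x(1) mult_nonpos_nonneg[of x "R ?j"] by linarith
      also have "\<dots> \<le> 1 / fact k"
        by (intro divide_left_mono fact_mono) auto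
      finally have "ln 2 * R (Suc k) \<le> ln 2 * (1 / fact k)"
        using ln2 by (intro mult_left_mono) auto
      also have "\<dots> \<le> 1 * (1 / fact k)" using ln2 by (intro mult_right_mono) auto
      finally show ?thesis by simp
    qed
    then have *: "\<alpha> * ln 2 * R (Suc k) \<le> R k"
      using R_rec[of k] by (simp add: x_def algebra_simps)
    have "\<alpha> ^ k * ln 2 ^ k * exp (- x) * (\<alpha> * ln 2 * R (Suc k)) \<le> \<alpha> ^ k * ln 2 ^ k * exp (- x) * R k"
      using assms ln2 by (intro mult_left_mono[OF *]) auto
    then show ?thesis unfolding pq q_def by (simp add: mult_ac)
  qed
  have "q \<longlonglongrightarrow> 0"
  proof (rule Lim_null_comparison)
    show "\<forall>\<^sub>F k in sequentially. norm (q k) \<le> exp (- x) * exp \<bar>x\<bar> * ((\<alpha> * ln 2) ^ k / fact k)"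
    proof (intro always_eventually allI)
      fix k
      have "norm (q k) = (\<alpha> * ln 2) ^ k * exp (- x) * \<bar>R k\<bar>"
        using assms by (simp add: q_def abs_mult power_mult_distrib)
      also have "\<dots> \<le> (\<alpha> * ln 2) ^ k * exp (- x) * (exp \<bar>x\<bar> / fact k)"
        using assms by (intro mult_left_mono R_bound) auto
      finally show "norm (q k) \<le> exp (- x) * exp \<bar>x\<bar> * ((\<alpha> * ln 2) ^ k / fact k)"
        by (simp add: mult_ac)
    qed
    have "(\<lambda>k. (\<alpha> * ln 2) ^ k / fact k) \<longlonglongrightarrow> 0"
      using summable_LIMSEQ_zero[OF summable_exp[of "\<alpha> * ln 2"]] by (simp add: divide_inverse mult.commute)
    then show "(\<lambda>k. exp (- x) * exp \<bar>x\<bar> * ((\<alpha> * ln 2) ^ k / fact k)) \<longlonglongrightarrow> 0"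
      by (rule tendsto_mult_right_zero)
  qed
  from telescope_sums'[OF this] have "(\<lambda>k. limit_prob \<alpha> k) sums q 0" by (simp add: pq)
  moreover have "q 0 = 1" by (simp add: q_def R_0 exp_minus)
  ultimately show "limit_prob \<alpha> sums 1" by simp
  show "limit_prob \<alpha> h \<ge> 0" by (rule nonneg)
qed

lemma pmf_limit_depth:
  assumes "very_simple c1 c2"
  shows "pmf (limit_depth (tree_alpha c1 c2)) h = limit_prob (tree_alpha c1 c2) h"
proof -
  let ?a = "tree_alpha c1 c2"
  have a: "0 < ?a" using assms by (simp add: very_simple_def)
  have "?a \<le> 2"
  proof (cases "c2 > 0")
    case True
    then obtain d :: nat where "d \<ge> 2" "?a = real d / (real d - 1)"
      using assms by (auto simp: very_simple_def)
    then show ?thesis by (simp add: divide_le_eq)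
  next
    case False
    then have "c2 / c1 \<le> 0" using assms by (simp add: very_simple_def divide_le_0_iff)
    then show ?thesis by (simp add: tree_alpha_def)
  qed
  note ls = limit_prob_nonneg[OF a this] limit_prob_sums[OF a this]
  have "(\<integral>\<^sup>+k. ennreal (limit_prob ?a k) \<partial>count_space UNIV) = (\<Sum>k. ennreal (limit_prob ?a k))"
    by (rule nn_integral_count_space_nat)
  also have "\<dots> = ennreal (\<Sum>k. limit_prob ?a k)"
    using ls by (intro suminf_ennreal2) (auto simp: sums_iff)
  also have "(\<Sum>k. limit_prob ?a k) = 1" using ls by (simp add: sums_iff)
  finally show ?thesis
    unfolding limit_depth_def using ls by (subst pmf_embed_pmf) auto
qed

end

theory Submission
  imports Defs
begin

text \<open>
  The idea is to compute the distribution of the centroid depth exactly for every \<open>n\<close> and to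
  read off its limit together with a bound that is uniform in \<open>n\<close>.

  Moving from a node \<open>p\<close> to its child \<open>c\<close> changes the total distance by
  \<open>n - 2 * card (subtree T c)\<close>. So the nodes whose subtree contains more than half of the tree
  form a path that starts at the root and ends at the centroid nearest to the root, and the
  centroid has depth at least \<open>h\<close> iff there is exactly one such node at depth \<open>h\<close>
  (\<open>card_majority_at_depth\<close>). The tail probability \<open>depth_tail c1 c2 n h\<close> is therefore an expected
  number of nodes.

  That expectation follows from growing the tree leaf by leaf. Attaching the next leaf to a node
  of outdegree \<open>k\<close>, in any of the \<open>k + 1\<close> positions, multiplies the weight by
  \<open>c1 * (\<alpha> - (\<alpha> - 1) * k)\<close> in total. Summed over a subtree of size \<open>s\<close>, the factors
  \<open>\<alpha> - (\<alpha> - 1) * k\<close> give \<open>s + \<alpha> - 1\<close> whatever its shape, so the expected number of nodes of depth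
  \<open>h\<close> with subtree size \<open>s\<close> satisfies a closed linear recursion in \<open>n\<close>. Its solution
  (\<open>tree_avg_census\<close>) is, for \<open>s < n\<close> and \<open>h \<ge> 1\<close>,
  \<open>\<alpha> ^ h * g s / (s * g n) * e\<close>, where \<open>g s = pochhammer \<alpha> (s - 1) / fact (s - 1)\<close> and \<open>e\<close> is the
  elementary symmetric polynomial of degree \<open>h - 1\<close> in \<open>1 / (s + 1), \<dots>, 1 / (n - 1)\<close>.

  Write \<open>Q h\<close> for the tail probability, \<open>N = n div 2 + 1\<close>, and \<open>e h\<close> for the elementary symmetric
  polynomial of degree \<open>h\<close> in \<open>1 / N, \<dots>, 1 / (n - 1)\<close>. Summation over \<open>s \<ge> N\<close> telescopes to
  \<open>\<alpha> * Q h - (\<alpha> - 1) * Q (h + 1) = \<alpha> ^ (h + 1) * (g N / g n) * e h\<close> (\<open>depth_tail_recursion\<close>).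
  Here \<open>g N / g n\<close> tends to \<open>2 powr (1 - \<alpha>)\<close> and \<open>e h\<close> to \<open>ln 2 ^ h / fact h\<close>. For \<open>\<alpha> = 1\<close> this is
  already the limit of \<open>Q h\<close>; for \<open>\<alpha> \<noteq> 1\<close> it determines the limits successively from \<open>Q 0 = 1\<close>.
  As \<open>Q\<close> is nonnegative and decreasing, the same identity bounds \<open>Q h\<close> by a constant times
  \<open>\<alpha> ^ h / fact h\<close>, eventually in \<open>n\<close> and for all \<open>h\<close> at once. Tannery's theorem then turns
  pointwise convergence of the probabilities into convergence of all moments.
\<close>

section \<open>Distances, subtrees and the centroid\<close>

definition subtree :: "plane_tree \<Rightarrow> nat \<Rightarrow> nat set" where
  "subtree T v = {w. (v, w) \<in> (tree_edges T)\<^sup>*}"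

abbreviation adjacency :: "plane_tree \<Rightarrow> (nat \<times> nat) set" where
  "adjacency T \<equiv> tree_edges T \<union> (tree_edges T)\<inverse>"

text \<open>
  If every step out of \<open>A\<close> ends in the same point \<open>p\<close>, a walk from \<open>A\<close> to the outside passes
  through \<open>p\<close> and continues from there with strictly fewer steps. Applied to a subtree and to its
  complement, this is what makes undirected distances computable.
\<close>

lemma relpow_exit:
  assumes exit: "\<And>x y. x \<in> A \<Longrightarrow> y \<notin> A \<Longrightarrow> (x, y) \<in> R \<Longrightarrow> y = p"
  shows "(x, w) \<in> R ^^ k \<Longrightarrow> x \<in> A \<Longrightarrow> w \<notin> A \<Longrightarrow> \<exists>j<k. (p, w) \<in> R ^^ j"
proof (induction k arbitrary: x)
  case (Suc k)
  from Suc.prems(1) obtain y where y: "(x, y) \<in> R" "(y, w) \<in> R ^^ k"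
    by (meson relpow_Suc_D2)
  show ?case
  proof (cases "y \<in> A")
    case True
    then show ?thesis using Suc.IH[OF y(2)] Suc.prems by (meson less_Suc_eq)
  next
    case False
    then show ?thesis using exit[OF Suc.prems(2) False y(1)] y(2) by blast
  qed
qed simp

lemma relpow_sym:
  assumes "sym R"
  shows "(u, v) \<in> R ^^ k \<longleftrightarrow> (v, u) \<in> R ^^ k"
proof -
  have "(v, u) \<in> R ^^ k" if "(u, v) \<in> R ^^ k" for u v
    using that
  proof (induction k arbitrary: u)
    case (Suc k)
    then obtain y where "(u, y) \<in> R" "(y, v) \<in> R ^^ k" by (meson relpow_Suc_D2)
    then show ?case using Suc.IH assms by (meson relpow_Suc_I symD)
  qed simp
  then show ?thesis by blast
qed

lemma tree_dist_le: "(u, v) \<in> adjacency T ^^ k \<Longrightarrow> tree_dist T u v \<le> k"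
  unfolding tree_dist_def by (rule Least_le)

lemma tree_dist_sym: "tree_dist T u v = tree_dist T v u"
proof -
  have "sym (adjacency T)" by (auto simp: sym_def)
  from relpow_sym[OF this] show ?thesis unfolding tree_dist_def by simp
qed

lemma tree_dist_self [simp]: "tree_dist T u u = 0"
  using tree_dist_le[of u u 0 T] by simp

lemma subtree_self [simp]: "v \<in> subtree T v"
  by (simp add: subtree_def)

lemma subtree_child: "(p, v) \<in> tree_edges T \<Longrightarrow> p \<in> subtree T u \<Longrightarrow> v \<in> subtree T u"
  by (auto simp: subtree_def)

context
  fixes n :: nat and T :: plane_tree
  assumes T: "T \<in> plane_increasing_trees n"
begin

lemma not_node_childless: "v \<notin> {1..n} \<Longrightarrow> T v = []"
  using T[unfolded plane_increasing_trees_def mem_Collect_eq, THEN conjunct1] by blast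

lemma distinct_children: "distinct (T v)"
proof (cases "v \<in> {1..n}")
  case True
  then show ?thesis
    using T[unfolded plane_increasing_trees_def mem_Collect_eq, THEN conjunct2, THEN conjunct1] by blast
qed (simp add: not_node_childless)

lemma ex1_parent: "w \<in> {2..n} \<Longrightarrow> \<exists>!v. v \<in> {1..n} \<and> w \<in> set (T v)"
  using T[unfolded plane_increasing_trees_def mem_Collect_eq, THEN conjunct2, THEN conjunct2] by (rule bspec)

lemma tree_edge_bounds:
  assumes "(v, w) \<in> tree_edges T"
  shows "v < w" "1 \<le> v" "w \<le> n"
proof -
  have w: "w \<in> set (T v)" using assms by (simp add: tree_edges_def)
  then have v: "v \<in> {1..n}" using not_node_childless[of v] by fastforce
  have "\<forall>w\<in>set (T v). v < w \<and> w \<le> n"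
    using bspec[OF T[unfolded plane_increasing_trees_def mem_Collect_eq, THEN conjunct2, THEN conjunct1] v]
    by (rule conjunct2)
  with v w show "v < w" "1 \<le> v" "w \<le> n" by simp_all
qed

lemma parent_exists: "w \<in> {2..n} \<Longrightarrow> \<exists>v. (v, w) \<in> tree_edges T"
  using ex1_parent unfolding tree_edges_def by blast

lemma parent_unique:
  assumes "(v, w) \<in> tree_edges T" "(v', w) \<in> tree_edges T"
  shows "v = v'"
proof -
  have "w \<in> {2..n}" "v \<in> {1..n}" "v' \<in> {1..n}"
    using tree_edge_bounds[OF assms(1)] tree_edge_bounds[OF assms(2)] by auto
  moreover have "w \<in> set (T v)" "w \<in> set (T v')" using assms by (auto simp: tree_edges_def)
  ultimately show ?thesis using ex1_parent[of w] by blast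
qed

lemma subtree_le: "w \<in> subtree T v \<Longrightarrow> v \<le> w"
  unfolding subtree_def mem_Collect_eq
  by (induction rule: rtrancl_induct) (use tree_edge_bounds in fastforce)+

lemma subtree_bounds: "w \<in> subtree T v \<Longrightarrow> v \<in> {1..n} \<Longrightarrow> w \<in> {1..n}"
  unfolding subtree_def mem_Collect_eq
  by (induction rule: rtrancl_induct) (use tree_edge_bounds in fastforce)+

lemma finite_subtree: "v \<in> {1..n} \<Longrightarrow> finite (subtree T v)"
  using subtree_bounds by (meson finite_atLeastAtMost finite_subset subsetI)

lemma subtree_root: "subtree T 1 = {1..n}" if "n \<ge> 1"
proof
  show "subtree T 1 \<subseteq> {1..n}" using subtree_bounds that by auto
  have "w \<in> {1..n} \<Longrightarrow> w \<in> subtree T 1" for w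
  proof (induction w rule: less_induct)
    case (less w)
    show ?case
    proof (cases "w = 1")
      case False
      then obtain v where v: "(v, w) \<in> tree_edges T" using parent_exists less.prems by force
      then have "v \<in> subtree T 1" using less.IH[of v] tree_edge_bounds[OF v] by auto
      then show ?thesis using v unfolding subtree_def by auto
    qed simp
  qed
  then show "{1..n} \<subseteq> subtree T 1" by blast
qed

lemma relpow_tree_dist:
  assumes "u \<in> {1..n}" "v \<in> {1..n}"
  shows "(u, v) \<in> adjacency T ^^ tree_dist T u v"
proof -
  have n: "n \<ge> 1" using assms by auto
  have sub: "(tree_edges T)\<^sup>* \<subseteq> (adjacency T)\<^sup>*" by (rule rtrancl_mono) auto
  have "sym ((adjacency T)\<^sup>*)" by (intro sym_rtrancl) (auto simp: sym_def)
  moreover have "(1, u) \<in> (adjacency T)\<^sup>*" "(1, v) \<in> (adjacency T)\<^sup>*"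
    using assms subtree_root[OF n] sub by (auto simp: subtree_def)
  ultimately have "(u, v) \<in> (adjacency T)\<^sup>*" by (meson rtrancl_trans symD)
  then obtain k where "(u, v) \<in> adjacency T ^^ k" by (auto simp: rtrancl_power)
  then show ?thesis unfolding tree_dist_def by (rule LeastI)
qed

text \<open>
  Parents are unique, so the edge above \<open>c\<close> is the only one that joins the subtree of \<open>c\<close> to the
  rest of the tree.
\<close>

lemma subtree_crossing:
  assumes edge: "(p, c) \<in> tree_edges T"
    and x: "x \<in> subtree T c" and y: "y \<notin> subtree T c" and xy: "(x, y) \<in> adjacency T"
  shows "x = c" "y = p"
proof -
  have yx: "(y, x) \<in> tree_edges T"
    using x y xy unfolding subtree_def by (auto intro: rtrancl_into_rtrancl)
  show "x = c"
  proof (rule ccontr)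
    assume "x \<noteq> c"
    then obtain z where "(c, z) \<in> (tree_edges T)\<^sup>*" "(z, x) \<in> tree_edges T"
      using x unfolding subtree_def by (auto elim: rtranclE)
    then show False using y parent_unique[OF yx] by (auto simp: subtree_def)
  qed
  then show "y = p" using parent_unique[OF yx] edge by simp
qed

lemma parent_not_in_subtree:
  assumes "(p, c) \<in> tree_edges T"
  shows "p \<notin> subtree T c"
  using subtree_le[of p c] tree_edge_bounds[OF assms] by auto

text \<open>
  Every walk from \<open>p\<close> into the subtree of \<open>c\<close> passes through \<open>c\<close>, and every walk out of it that
  starts at \<open>c\<close> passes through \<open>p\<close>.
\<close>

lemma tree_dist_edge:
  assumes edge: "(p, c) \<in> tree_edges T" and w: "w \<in> {1..n}"
  shows "w \<in> subtree T c \<Longrightarrow> tree_dist T p w = Suc (tree_dist T c w)"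
    and "w \<notin> subtree T c \<Longrightarrow> tree_dist T c w = Suc (tree_dist T p w)"
proof -
  have pc: "p \<in> {1..n}" "c \<in> {1..n}" using tree_edge_bounds[OF edge] by auto
  have adj: "(p, c) \<in> adjacency T" "(c, p) \<in> adjacency T" using edge by auto
  have le: "tree_dist T p w \<le> Suc (tree_dist T c w)" "tree_dist T c w \<le> Suc (tree_dist T p w)"
    using relpow_tree_dist[OF pc(1) w] relpow_tree_dist[OF pc(2) w] adj
    by (meson relpow_Suc_I2 tree_dist_le)+
  show "tree_dist T p w = Suc (tree_dist T c w)" if "w \<in> subtree T c"
  proof -
    have exit: "y = c" if "x \<in> - subtree T c" "y \<notin> - subtree T c" "(x, y) \<in> adjacency T" for x y
      using subtree_crossing(1)[OF edge, of y x] that by auto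
    have "\<exists>j<tree_dist T p w. (c, w) \<in> adjacency T ^^ j"
      by (rule relpow_exit[where A = "- subtree T c", OF _ relpow_tree_dist[OF pc(1) w]])
        (use exit that parent_not_in_subtree[OF edge] in blast)+
    then show ?thesis using tree_dist_le le(1) by fastforce
  qed
  show "tree_dist T c w = Suc (tree_dist T p w)" if "w \<notin> subtree T c"
  proof -
    have "\<exists>j<tree_dist T c w. (p, w) \<in> adjacency T ^^ j"
      by (rule relpow_exit[where A = "subtree T c", OF _ relpow_tree_dist[OF pc(2) w]])
        (use subtree_crossing(2)[OF edge] that in auto)
    then show ?thesis using tree_dist_le le(2) by fastforce
  qed
qed

lemma depth_edge:
  assumes "(p, c) \<in> tree_edges T"
  shows "tree_dist T 1 c = Suc (tree_dist T 1 p)"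
proof -
  have "1 \<notin> subtree T c" "1 \<in> {1..n}"
    using subtree_le[of 1 c] tree_edge_bounds[OF assms] by auto
  then show ?thesis using tree_dist_edge(2)[OF assms, of 1] by (simp add: tree_dist_sym)
qed

text \<open>
  Stepping from \<open>p\<close> to \<open>c\<close> brings the nodes of the subtree of \<open>c\<close> one edge closer and moves
  all other nodes one edge away.
\<close>

lemma total_dist_edge:
  assumes edge: "(p, c) \<in> tree_edges T"
  shows "total_dist n T p + n = total_dist n T c + 2 * card (subtree T c)"
proof -
  let ?S = "subtree T c"
  have S: "?S \<subseteq> {1..n}" using subtree_bounds tree_edge_bounds[OF edge] by auto
  have fin: "finite ?S" using S finite_subset by blast
  have split: "total_dist n T v = (\<Sum>w\<in>?S. tree_dist T v w) + (\<Sum>w\<in>{1..n} - ?S. tree_dist T v w)" for v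
    unfolding total_dist_def using sum.subset_diff[OF S] by (simp add: add.commute)
  have "(\<Sum>w\<in>?S. tree_dist T p w) = (\<Sum>w\<in>?S. tree_dist T c w + 1)"
    by (rule sum.cong) (use S tree_dist_edge(1)[OF edge] in auto)
  moreover have "(\<Sum>w\<in>{1..n} - ?S. tree_dist T c w) = (\<Sum>w\<in>{1..n} - ?S. tree_dist T p w + 1)"
    by (rule sum.cong) (use tree_dist_edge(2)[OF edge] in auto)
  moreover have "card ({1..n} - ?S) = n - card ?S" using card_Diff_subset[OF fin S] by simp
  moreover have "card ?S \<le> n" using card_mono[OF _ S] by simp
  ultimately show ?thesis unfolding split sum.distrib by simp
qed

lemma ancestors_comparable:
  assumes "w \<in> subtree T u" "w \<in> subtree T v"
  shows "v \<in> subtree T u \<or> u \<in> subtree T v"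
proof -
  have "single_valued ((tree_edges T)\<inverse>)"
    using parent_unique by (auto simp: single_valued_def)
  from single_valued_confluent[OF this, of w u v] show ?thesis
    using assms by (auto simp: subtree_def rtrancl_converse)
qed

lemma subtree_mono: "w \<in> subtree T u \<Longrightarrow> subtree T w \<subseteq> subtree T u"
  by (auto simp: subtree_def)

lemma depth_subtree:
  assumes "w \<in> subtree T u"
  shows "tree_dist T 1 u + (if w = u then 0 else 1) \<le> tree_dist T 1 w"
  using assms unfolding subtree_def mem_Collect_eq
  by (induction rule: rtrancl_induct) (use depth_edge in \<open>auto split: if_splits\<close>)

definition majority_nodes :: "nat set" where
  "majority_nodes = {v \<in> {1..n}. n div 2 < card (subtree T v)}"

lemma majority_up:
  assumes "w \<in> majority_nodes" "w \<in> subtree T u" "u \<in> {1..n}"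
  shows "u \<in> majority_nodes"
  using assms card_mono[OF finite_subtree subtree_mono, of u w]
  by (auto simp: majority_nodes_def)

text \<open>
  Two subtrees that both contain more than half of the nodes intersect, and a common node has
  its ancestors on one path.
\<close>

lemma majority_comparable:
  assumes "u \<in> majority_nodes" "v \<in> majority_nodes"
  shows "v \<in> subtree T u \<or> u \<in> subtree T v"
proof (rule ccontr)
  assume "\<not> ?thesis"
  then have disj: "subtree T u \<inter> subtree T v = {}" using ancestors_comparable by blast
  have uv: "u \<in> {1..n}" "v \<in> {1..n}" using assms by (auto simp: majority_nodes_def)
  have "card (subtree T u) + card (subtree T v) = card (subtree T u \<union> subtree T v)"
    using disj finite_subtree uv by (simp add: card_Un_disjoint)
  also have "\<dots> \<le> card {1..n}" by (rule card_mono) (use subtree_bounds uv in auto)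
  finally show False using assms by (auto simp: majority_nodes_def)
qed

lemma majority_same_depth:
  assumes "u \<in> majority_nodes" "v \<in> majority_nodes" "tree_dist T 1 u = tree_dist T 1 v"
  shows "u = v"
  using majority_comparable[OF assms(1,2)] depth_subtree[of u v] depth_subtree[of v u] assms(3)
  by (auto split: if_splits)

text \<open>
  The total distance drops strictly with every step down that stays within the majority nodes.
\<close>

lemma total_dist_majority:
  assumes "v \<in> subtree T u" "v \<in> majority_nodes" "u \<in> {1..n}"
  shows "total_dist n T v + (if v = u then 0 else 1) \<le> total_dist n T u"
  using assms(1,2) unfolding subtree_def mem_Collect_eq
proof (induction rule: rtrancl_induct)
  case (step y z)
  have "y \<in> majority_nodes" using majority_up[OF step.prems, of y] step.hyps tree_edge_bounds[OF step.hyps(2)]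
    by (auto simp: subtree_def)
  then have "total_dist n T y \<le> total_dist n T u" using step.IH by simp
  moreover have "total_dist n T z < total_dist n T y"
    using total_dist_edge[OF step.hyps(2)] step.prems by (auto simp: majority_nodes_def)
  ultimately show ?case by simp
qed simp

text \<open>
  Climbing from a node outside the majority nodes never increases the total distance, and the
  climb ends at the latest at the root, which is a majority node.
\<close>

lemma total_dist_ancestor_in_majority:
  assumes "v \<in> {1..n}"
  shows "\<exists>u\<in>majority_nodes. v \<in> subtree T u \<and> total_dist n T u \<le> total_dist n T v"
  using assms
proof (induction v rule: less_induct)
  case (less v)
  show ?case
  proof (cases "v \<in> majority_nodes")
    case True
    then show ?thesis by (intro bexI[of _ v]) auto
  next
    case False
    then have small: "card (subtree T v) \<le> n div 2" using less.prems by (auto simp: majority_nodes_def)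
    have "v \<noteq> 1" using subtree_root small less.prems by auto
    then obtain p where p: "(p, v) \<in> tree_edges T" using parent_exists[of v] less.prems by force
    then obtain u where "u \<in> majority_nodes" "p \<in> subtree T u" "total_dist n T u \<le> total_dist n T p"
      using less.IH[of p] tree_edge_bounds[OF p] by auto
    moreover have "total_dist n T p \<le> total_dist n T v" using total_dist_edge[OF p] small by linarith
    ultimately show ?thesis using subtree_child[OF p] by (meson order_trans)
  qed
qed

lemma ancestor_at_depth:
  assumes "v \<in> {1..n}" "h \<le> tree_dist T 1 v"
  shows "\<exists>u\<in>{1..n}. v \<in> subtree T u \<and> tree_dist T 1 u = h"
  using assms
proof (induction v rule: less_induct)
  case (less v)
  show ?case
  proof (cases "h = tree_dist T 1 v")
    case True
    then show ?thesis using less.prems by (intro bexI[of _ v]) auto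
  next
    case False
    then have "v \<noteq> 1" using less.prems by auto
    then obtain p where p: "(p, v) \<in> tree_edges T" using parent_exists[of v] less.prems by force
    then obtain u where "u \<in> {1..n}" "p \<in> subtree T u" "tree_dist T 1 u = h"
      using less.IH[of p] tree_edge_bounds[OF p] depth_edge[OF p] False less.prems by auto
    then show ?thesis using subtree_child[OF p] by blast
  qed
qed

text \<open>
  The deepest majority node \<open>z\<close> minimises the total distance, since from any node one can climb
  to a majority node and then descend to \<open>z\<close> without increasing it. Equality of the total
  distances is possible only if \<open>z\<close> is an ancestor of the starting node, so \<open>z\<close> has the depth of
  the centroid nearest to the root.
\<close>

lemma centroid_depth_majority:
  assumes n: "n \<ge> 1"
  obtains z where "z \<in> majority_nodes" "centroid_depth n T = tree_dist T 1 z"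
    "\<And>u. u \<in> majority_nodes \<Longrightarrow> z \<in> subtree T u"
proof -
  have fin: "finite majority_nodes" by (simp add: majority_nodes_def)
  have root: "1 \<in> majority_nodes" using n subtree_root by (auto simp: majority_nodes_def)
  obtain z where z: "z \<in> majority_nodes" and zmax: "\<And>u. u \<in> majority_nodes \<Longrightarrow> tree_dist T 1 u \<le> tree_dist T 1 z"
  proof -
    let ?m = "Max (tree_dist T 1 ` majority_nodes)"
    have "?m \<in> tree_dist T 1 ` majority_nodes" using fin root by (intro Max_in) auto
    then obtain z where "z \<in> majority_nodes" "?m = tree_dist T 1 z" by blast
    moreover have "tree_dist T 1 u \<le> ?m" if "u \<in> majority_nodes" for u using that fin by auto
    ultimately show ?thesis using that by metis
  qed
  have zn: "z \<in> {1..n}" using z by (simp add: majority_nodes_def)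
  have below: "z \<in> subtree T u" if "u \<in> majority_nodes" for u
    using majority_comparable[OF that z] zmax[OF that] depth_subtree[of u z] by (auto split: if_splits)
  have min: "total_dist n T z \<le> total_dist n T v \<and>
      (total_dist n T v \<le> total_dist n T z \<longrightarrow> tree_dist T 1 z \<le> tree_dist T 1 v)" if v: "v \<in> {1..n}" for v
  proof -
    obtain u where u: "u \<in> majority_nodes" "v \<in> subtree T u" "total_dist n T u \<le> total_dist n T v"
      using total_dist_ancestor_in_majority[OF v] by blast
    have le: "total_dist n T z + (if z = u then 0 else 1) \<le> total_dist n T u"
      by (rule total_dist_majority[OF below[OF u(1)] z]) (use u in \<open>simp add: majority_nodes_def\<close>)
    moreover have "tree_dist T 1 u \<le> tree_dist T 1 v" using depth_subtree[OF u(2)] by simp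
    ultimately show ?thesis using u(3) by (cases "z = u") auto
  qed
  have zc: "z \<in> centroids n T"
    unfolding centroids_def is_arg_min_def using zn min by (auto simp: not_less)
  have low: "tree_dist T 1 z \<le> tree_dist T 1 v" if "v \<in> centroids n T" for v
    using that min zn unfolding centroids_def is_arg_min_def by (auto simp: not_less)
  have "centroid n T \<in> centroids n T \<and> tree_dist T 1 (centroid n T) \<le> tree_dist T 1 z"
    unfolding centroid_def using arg_min_nat_lemma[of "\<lambda>v. v \<in> centroids n T" z "tree_dist T 1"] zc by blast
  then have "centroid_depth n T = tree_dist T 1 z"
    using low unfolding centroid_depth_def by (meson le_antisym)
  then show ?thesis using that z below by blast
qed

text \<open>
  This turns the event that the centroid has depth at least \<open>h\<close> into a count of nodes, whose
  expectation is additive.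
\<close>

lemma card_majority_at_depth:
  assumes n: "n \<ge> 1"
  shows "card {v \<in> {1..n}. tree_dist T 1 v = h \<and> n div 2 < card (subtree T v)} =
    (if h \<le> centroid_depth n T then 1 else 0)"
proof -
  let ?A = "{v \<in> {1..n}. tree_dist T 1 v = h \<and> n div 2 < card (subtree T v)}"
  have A: "?A = {v \<in> majority_nodes. tree_dist T 1 v = h}" by (auto simp: majority_nodes_def)
  obtain z where z: "z \<in> majority_nodes" "centroid_depth n T = tree_dist T 1 z"
    "\<And>u. u \<in> majority_nodes \<Longrightarrow> z \<in> subtree T u"
    using centroid_depth_majority[OF n] by blast
  show ?thesis
  proof (cases "h \<le> centroid_depth n T")
    case True
    then obtain u where u: "u \<in> {1..n}" "z \<in> subtree T u" "tree_dist T 1 u = h"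
      using ancestor_at_depth[of z h] z by (auto simp: majority_nodes_def)
    then have "?A = {u}" unfolding A using majority_up[OF z(1)] majority_same_depth by auto
    then show ?thesis using True by simp
  next
    case False
    have "tree_dist T 1 v \<le> tree_dist T 1 z" if "v \<in> majority_nodes" for v
      using depth_subtree[OF z(3)[OF that]] by simp
    then have "?A = {}" unfolding A using False z(2) by auto
    then show ?thesis using False by simp
  qed
qed

end

section \<open>Growth by one leaf\<close>

definition insert_child :: "plane_tree \<Rightarrow> nat \<Rightarrow> nat \<Rightarrow> nat \<Rightarrow> plane_tree" where
  "insert_child T v i m = T(v := take i (T v) @ m # drop i (T v))"

lemma set_insert_child:
  "set (insert_child T v i m u) = (if u = v then insert m (set (T v)) else set (T u))"
proof -
  have "set (take i (T v)) \<union> set (drop i (T v)) = set (T v)"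
    by (metis append_take_drop_id set_append)
  then show ?thesis by (auto simp: insert_child_def)
qed

lemma length_insert_child:
  "length (insert_child T v i m u) = length (T u) + (if u = v then 1 else 0)"
  by (simp add: insert_child_def min_def)

lemma tree_edges_insert_child:
  "tree_edges (insert_child T v i m) = insert (v, m) (tree_edges T)"
  by (auto simp: tree_edges_def set_insert_child split: if_splits)

lemma children_bounds:
  assumes "T \<in> plane_increasing_trees n" "w \<in> set (T v)"
  shows "v < w" "1 \<le> v" "w \<le> n"
  using tree_edge_bounds[OF assms(1), of v w] assms(2) by (auto simp: tree_edges_def)

lemma plane_increasing_treesI:
  assumes "\<And>v. v \<notin> {1..n} \<Longrightarrow> T v = []"
    and "\<And>v. v \<in> {1..n} \<Longrightarrow> distinct (T v)"
    and "\<And>v w. v \<in> {1..n} \<Longrightarrow> w \<in> set (T v) \<Longrightarrow> v < w \<and> w \<le> n"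
    and "\<And>w. w \<in> {2..n} \<Longrightarrow> \<exists>!v. v \<in> {1..n} \<and> w \<in> set (T v)"
  shows "T \<in> plane_increasing_trees n"
  unfolding plane_increasing_trees_def using assms by (intro CollectI conjI allI ballI impI) blast+

lemma insert_child_in_trees:
  assumes T: "T \<in> plane_increasing_trees n" and v: "v \<in> {1..n}"
  shows "insert_child T v i (Suc n) \<in> plane_increasing_trees (Suc n)"
proof (rule plane_increasing_treesI)
  have fresh: "Suc n \<notin> set (T u)" for u using children_bounds(3)[OF T, of "Suc n" u] by auto
  show "insert_child T v i (Suc n) u = []" if "u \<notin> {1..Suc n}" for u
    using that v not_node_childless[OF T, of u] by (auto simp: insert_child_def)
  show "distinct (insert_child T v i (Suc n) u)" for u
    using distinct_children[OF T] fresh[of v] set_take_subset[of i "T v"] set_drop_subset[of i "T v"]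
    by (auto simp: insert_child_def set_take_disj_set_drop_if_distinct)
  show "u < w \<and> w \<le> Suc n" if "w \<in> set (insert_child T v i (Suc n) u)" for u w
    using that children_bounds[OF T, of w u] v by (auto simp: set_insert_child split: if_splits)
  show "\<exists>!u. u \<in> {1..Suc n} \<and> w \<in> set (insert_child T v i (Suc n) u)" if w: "w \<in> {2..Suc n}" for w
  proof (cases "w = Suc n")
    case True
    then show ?thesis using v fresh by (intro ex1I[of _ v]) (auto simp: set_insert_child split: if_splits)
  next
    case False
    then have "\<exists>!u. u \<in> {1..n} \<and> w \<in> set (T u)" using ex1_parent[OF T] w by auto
    moreover have "u \<in> {1..Suc n} \<and> w \<in> set (insert_child T v i (Suc n) u) \<longleftrightarrow> u \<in> {1..n} \<and> w \<in> set (T u)" for u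
      using False not_node_childless[OF T, of u] by (cases "u = Suc n") (auto simp: set_insert_child)
    ultimately show ?thesis by simp
  qed
qed

text \<open>
  The largest label is a leaf; deleting it undoes the insertion.
\<close>

lemma insert_child_surj:
  assumes S: "S \<in> plane_increasing_trees (Suc n)" and n: "n \<ge> 1"
  shows "\<exists>T\<in>plane_increasing_trees n. \<exists>v\<in>{1..n}. \<exists>i\<le>length (T v). S = insert_child T v i (Suc n)"
proof -
  have "\<exists>!v. v \<in> {1..Suc n} \<and> Suc n \<in> set (S v)" using ex1_parent[OF S, of "Suc n"] n by auto
  then obtain v where v: "Suc n \<in> set (S v)" and v_unique: "\<And>u. u \<in> {1..Suc n} \<Longrightarrow> Suc n \<in> set (S u) \<Longrightarrow> u = v"
    by blast
  have vn: "v \<in> {1..n}" using children_bounds[OF S v] by auto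
  obtain xs ys where split: "S v = xs @ Suc n # ys" using v by (meson split_list)
  have d: "distinct (xs @ Suc n # ys)" using distinct_children[OF S, of v] split by simp
  define T where "T = S(v := xs @ ys)"
  have last_leaf: "S (Suc n) = []"
    using children_bounds[OF S, of _ "Suc n"] by (cases "S (Suc n)") fastforce+
  have sT: "set (T u) = set (S u) - {Suc n}" for u
  proof (cases "u = v")
    case True
    then show ?thesis using d by (auto simp: T_def split)
  next
    case False
    then have "Suc n \<notin> set (S u)" using v_unique[of u] children_bounds[OF S, of "Suc n" u] by auto
    then show ?thesis using False by (simp add: T_def)
  qed
  have "T \<in> plane_increasing_trees n"
  proof (rule plane_increasing_treesI)
    show "T u = []" if "u \<notin> {1..n}" for u
      using that vn not_node_childless[OF S, of u] last_leaf by (cases "u = Suc n") (auto simp: T_def)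
    show "distinct (T u)" for u using distinct_children[OF S, of u] d by (auto simp: T_def)
    show "u < w \<and> w \<le> n" if "w \<in> set (T u)" for u w
      using that children_bounds[OF S, of w u] by (auto simp: sT)
    show "\<exists>!u. u \<in> {1..n} \<and> w \<in> set (T u)" if w: "w \<in> {2..n}" for w
    proof -
      have "\<exists>!u. u \<in> {1..Suc n} \<and> w \<in> set (S u)" using ex1_parent[OF S] w by auto
      moreover have "u \<in> {1..Suc n} \<and> w \<in> set (S u) \<longleftrightarrow> u \<in> {1..n} \<and> w \<in> set (T u)" for u
        using w last_leaf by (cases "u = Suc n") (auto simp: sT)
      ultimately show ?thesis by simp
    qed
  qed
  moreover have "S = insert_child T v (length xs) (Suc n)" "length xs \<le> length (T v)"
    by (auto simp: insert_child_def T_def split fun_eq_iff)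
  ultimately show ?thesis using vn by blast
qed

lemma insert_child_inject:
  assumes T: "T \<in> plane_increasing_trees n" "T' \<in> plane_increasing_trees n"
    and i: "i \<le> length (T v)" "i' \<le> length (T' v')"
    and eq: "insert_child T v i (Suc n) = insert_child T' v' i' (Suc n)"
  shows "T = T'" "v = v'" "i = i'"
proof -
  have fresh: "Suc n \<notin> set (T u)" "Suc n \<notin> set (T' u)" for u
    using children_bounds(3)[OF T(1), of "Suc n" u] children_bounds(3)[OF T(2), of "Suc n" u] by auto
  have "Suc n \<in> set (insert_child T' v' i' (Suc n) v)" unfolding eq[symmetric] by (simp add: set_insert_child)
  then show v: "v = v'" using fresh by (auto simp: set_insert_child split: if_splits)
  have "take i (T v) @ Suc n # drop i (T v) = take i' (T' v) @ Suc n # drop i' (T' v)"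
    using fun_cong[OF eq, of v] v by (simp add: insert_child_def)
  moreover have "Suc n \<notin> set (take i (T v))" "Suc n \<notin> set (drop i (T v))"
    using fresh by (meson in_set_takeD in_set_dropD)+
  ultimately have "take i (T v) = take i' (T' v) \<and> drop i (T v) = drop i' (T' v)"
    by (simp add: append_Cons_eq_iff)
  then have td: "take i (T v) = take i' (T' v)" "drop i (T v) = drop i' (T' v)" by blast+
  then have Tv: "T v = T' v" by (metis append_take_drop_id)
  have "length (take i (T v)) = length (take i' (T' v))" using td by simp
  then show "i = i'" using i v Tv by simp
  show "T = T'"
  proof
    fix u show "T u = T' u"
      using fun_cong[OF eq, of u] v Tv by (cases "u = v") (auto simp: insert_child_def)
  qed
qed

text \<open>
  A plane increasing tree with \<open>n + 1\<close> nodes arises in exactly one way by inserting the leaf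
  \<open>n + 1\<close> into a tree with \<open>n\<close> nodes.
\<close>

lemma sum_trees_Suc:
  fixes F :: "plane_tree \<Rightarrow> real"
  assumes n: "n \<ge> 1"
  shows "(\<Sum>S\<in>plane_increasing_trees (Suc n). F S) =
    (\<Sum>T\<in>plane_increasing_trees n. \<Sum>v\<in>{1..n}. \<Sum>i\<le>length (T v). F (insert_child T v i (Suc n)))"
proof -
  let ?D = "SIGMA T:plane_increasing_trees n. SIGMA v:{1..n}. {..length (T v)}"
  let ?f = "\<lambda>(T, v, i). insert_child T v i (Suc n)"
  have "inj_on ?f ?D"
    unfolding inj_on_def using insert_child_inject[where n = n] by (auto; blast)
  moreover have "?f ` ?D = plane_increasing_trees (Suc n)"
  proof
    show "?f ` ?D \<subseteq> plane_increasing_trees (Suc n)" using insert_child_in_trees by auto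
    show "plane_increasing_trees (Suc n) \<subseteq> ?f ` ?D"
    proof
      fix S assume "S \<in> plane_increasing_trees (Suc n)"
      from insert_child_surj[OF this n] obtain T v i where
        "T \<in> plane_increasing_trees n" "v \<in> {1..n}" "i \<le> length (T v)" "S = insert_child T v i (Suc n)"
        by blast
      then show "S \<in> ?f ` ?D" by (intro image_eqI[of _ _ "(T, v, i)"]) auto
    qed
  qed
  ultimately have "bij_betw ?f ?D (plane_increasing_trees (Suc n))" by (simp add: bij_betw_def)
  from sum.reindex_bij_betw[OF this, of F]
  have "(\<Sum>S\<in>plane_increasing_trees (Suc n). F S) = (\<Sum>x\<in>?D. F (?f x))" by simp
  also have "\<dots> = (\<Sum>T\<in>plane_increasing_trees n. \<Sum>y\<in>(SIGMA v:{1..n}. {..length (T v)}). F (?f (T, y)))"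
    by (subst sum.Sigma) (auto simp: split_def finite_plane_increasing_trees split_def)
  also have "\<dots> = (\<Sum>T\<in>plane_increasing_trees n. \<Sum>v\<in>{1..n}. \<Sum>i\<le>length (T v). F (?f (T, v, i)))"
    by (intro sum.cong refl, subst sum.Sigma) (auto simp: split_def)
  finally show ?thesis by simp
qed

text \<open>
  Up to normalisation, the probability that the growth process attaches the next leaf to \<open>v\<close>.
\<close>

definition node_weight :: "real \<Rightarrow> plane_tree \<Rightarrow> nat \<Rightarrow> real" where
  "node_weight \<alpha> T v = \<alpha> - (\<alpha> - 1) * real (length (T v))"

lemma degree_weights_Suc:
  assumes "c1 > 0"
  shows "real (Suc k) * fps_nth (degree_weights c1 c2) (Suc k) =
    c1 * (tree_alpha c1 c2 - (tree_alpha c1 c2 - 1) * real k) * fps_nth (degree_weights c1 c2) k"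
proof -
  let ?a = "tree_alpha c1 c2"
  let ?A = "c1 ^ Suc k * (\<Prod>j<Suc k. ?a - real j * (?a - 1))"
  have "real (Suc k) * fps_nth (degree_weights c1 c2) (Suc k) = real (Suc k) * (?A / fact (Suc k))"
    by (simp only: degree_weights_nth[OF assms])
  also have "\<dots> = ?A / fact k" by (simp add: divide_simps del: power_Suc prod.lessThan_Suc)
  finally show ?thesis by (simp add: degree_weights_nth[OF assms] mult_ac)
qed

text \<open>
  The left-hand side is the total weight of the trees that arise by inserting the leaf at one of
  the positions among the children of \<open>v\<close>, since all of these have the same weight.
\<close>

lemma tree_weight_insert_child:
  assumes c1: "c1 > 0" and T: "T \<in> plane_increasing_trees n" and v: "v \<in> {1..n}"
  shows "real (Suc (length (T v))) * tree_weight c1 c2 (Suc n) (insert_child T v i (Suc n)) =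
    c1 * node_weight (tree_alpha c1 c2) T v * tree_weight c1 c2 n T"
proof -
  let ?\<phi> = "fps_nth (degree_weights c1 c2)"
  let ?S = "insert_child T v i (Suc n)"
  have "T (Suc n) = []" using not_node_childless[OF T, of "Suc n"] by simp
  then have "?\<phi> (length (?S (Suc n))) = 1"
    using v degree_weights_nth[OF c1, of c2 0] by (auto simp: length_insert_child)
  then have "tree_weight c1 c2 (Suc n) ?S = (\<Prod>u\<in>{1..n}. ?\<phi> (length (?S u)))"
    by (simp add: tree_weight_def)
  also have "\<dots> = ?\<phi> (Suc (length (T v))) * (\<Prod>u\<in>{1..n} - {v}. ?\<phi> (length (T u)))"
    using v by (subst prod.remove[of _ v]) (auto simp: length_insert_child intro!: prod.cong)
  finally have "real (Suc (length (T v))) * tree_weight c1 c2 (Suc n) ?S =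
      (real (Suc (length (T v))) * ?\<phi> (Suc (length (T v)))) * (\<Prod>u\<in>{1..n} - {v}. ?\<phi> (length (T u)))"
    by simp
  also have "\<dots> = c1 * node_weight (tree_alpha c1 c2) T v *
      (?\<phi> (length (T v)) * (\<Prod>u\<in>{1..n} - {v}. ?\<phi> (length (T u))))"
    unfolding degree_weights_Suc[OF c1] by (simp add: node_weight_def mult_ac)
  also have "?\<phi> (length (T v)) * (\<Prod>u\<in>{1..n} - {v}. ?\<phi> (length (T u))) = tree_weight c1 c2 n T"
    unfolding tree_weight_def using v by (subst prod.remove[of "{1..n}" v]) auto
  finally show ?thesis .
qed

lemma weighted_sum_trees_Suc:
  assumes c1: "c1 > 0" and n: "n \<ge> 1"
    and f: "\<And>T v i. T \<in> plane_increasing_trees n \<Longrightarrow> v \<in> {1..n} \<Longrightarrow> f (insert_child T v i (Suc n)) = F T v"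
  shows "(\<Sum>S\<in>plane_increasing_trees (Suc n). tree_weight c1 c2 (Suc n) S * f S) =
    c1 * (\<Sum>T\<in>plane_increasing_trees n. tree_weight c1 c2 n T *
      (\<Sum>v\<in>{1..n}. node_weight (tree_alpha c1 c2) T v * F T v))"
proof -
  have "(\<Sum>i\<le>length (T v). tree_weight c1 c2 (Suc n) (insert_child T v i (Suc n)) * f (insert_child T v i (Suc n)))
      = c1 * (tree_weight c1 c2 n T * (node_weight (tree_alpha c1 c2) T v * F T v))"
    if T: "T \<in> plane_increasing_trees n" and v: "v \<in> {1..n}" for T v
  proof -
    have w: "tree_weight c1 c2 (Suc n) (insert_child T v i (Suc n)) =
        c1 * node_weight (tree_alpha c1 c2) T v * tree_weight c1 c2 n T / real (Suc (length (T v)))" for i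
      using tree_weight_insert_child[OF c1 T v, of c2 i] by (simp add: field_simps)
    show ?thesis unfolding w f[OF T v] by (simp del: of_nat_Suc)
  qed
  then show ?thesis
    unfolding sum_trees_Suc[OF n] by (simp add: sum_distrib_left)
qed

section \<open>Attachment weights\<close>

context
  fixes n :: nat and T :: plane_tree
  assumes T: "T \<in> plane_increasing_trees n"
begin

lemma sum_length_children:
  assumes "finite U"
  shows "(\<Sum>v\<in>U. length (T v)) = card (\<Union>v\<in>U. set (T v))"
proof -
  have "set (T u) \<inter> set (T v) = {}" if "u \<noteq> v" for u v
    using parent_unique[OF T, of u _ v] that by (auto simp: tree_edges_def)
  then have "card (\<Union>v\<in>U. set (T v)) = (\<Sum>v\<in>U. card (set (T v)))"
    using assms by (intro card_UN_disjoint) auto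
  then show ?thesis using distinct_card[OF distinct_children[OF T]] by simp
qed

lemma sum_node_weight:
  assumes "finite U"
  shows "(\<Sum>v\<in>U. node_weight \<alpha> T v) = \<alpha> * real (card U) - (\<alpha> - 1) * real (card (\<Union>v\<in>U. set (T v)))"
  unfolding sum_length_children[OF assms, symmetric] node_weight_def
  by (simp add: sum_subtractf sum_distrib_left)

text \<open>
  The outdegrees in a subtree sum up to its number of edges, so its attachment weight depends on
  its size alone. This is what closes the recursion for the expected census below.
\<close>

lemma sum_node_weight_subtree:
  assumes u: "u \<in> {1..n}"
  shows "(\<Sum>v\<in>subtree T u. node_weight \<alpha> T v) = real (card (subtree T u)) + \<alpha> - 1"
proof -
  have "(\<Union>v\<in>subtree T u. set (T v)) = subtree T u - {u}"
  proof (intro equalityI subsetI)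
    fix w assume "w \<in> (\<Union>v\<in>subtree T u. set (T v))"
    then obtain v where v: "v \<in> subtree T u" "(v, w) \<in> tree_edges T" by (auto simp: tree_edges_def)
    then show "w \<in> subtree T u - {u}"
      using subtree_child tree_edge_bounds[OF T v(2)] subtree_le[OF T v(1)] by auto
  next
    fix w assume "w \<in> subtree T u - {u}"
    then obtain v where "(u, v) \<in> (tree_edges T)\<^sup>*" "(v, w) \<in> tree_edges T"
      by (auto simp: subtree_def elim: rtranclE)
    then show "w \<in> (\<Union>v\<in>subtree T u. set (T v))" by (auto simp: subtree_def tree_edges_def)
  qed
  moreover have "card (subtree T u) \<ge> 1" using finite_subtree[OF T u] subtree_self[of u T]
    by (metis card_0_eq empty_iff less_one not_less)
  ultimately show ?thesis
    using finite_subtree[OF T u] by (simp add: sum_node_weight card_Diff_singleton of_nat_diff algebra_simps)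
qed

lemma sum_node_weight_all:
  assumes "n \<ge> 1"
  shows "(\<Sum>v\<in>{1..n}. node_weight \<alpha> T v) = real n + \<alpha> - 1"
  using sum_node_weight_subtree[of 1 \<alpha>] subtree_root[OF T assms] assms by simp

lemma children_of_layer:
  "(\<Union>v\<in>{v \<in> {1..n}. tree_dist T 1 v = h}. set (T v)) = {w \<in> {1..n}. tree_dist T 1 w = Suc h}"
proof (intro equalityI subsetI)
  fix w assume "w \<in> (\<Union>v\<in>{v \<in> {1..n}. tree_dist T 1 v = h}. set (T v))"
  then obtain v where v: "(v, w) \<in> tree_edges T" "tree_dist T 1 v = h" by (auto simp: tree_edges_def)
  then show "w \<in> {w \<in> {1..n}. tree_dist T 1 w = Suc h}"
    using depth_edge[OF T v(1)] tree_edge_bounds[OF T v(1)] by simp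
next
  fix w assume w: "w \<in> {w \<in> {1..n}. tree_dist T 1 w = Suc h}"
  then have "w \<noteq> 1" by auto
  then obtain v where v: "(v, w) \<in> tree_edges T" using parent_exists[OF T, of w] w by force
  then show "w \<in> (\<Union>v\<in>{v \<in> {1..n}. tree_dist T 1 v = h}. set (T v))"
    using depth_edge[OF T v(1)] tree_edge_bounds[OF T v(1)] w by (auto simp: tree_edges_def)
qed

lemma subtree_insert_child:
  assumes v: "v \<in> {1..n}"
  shows "u \<in> {1..n} \<Longrightarrow> subtree (insert_child T v i (Suc n)) u =
      (if v \<in> subtree T u then insert (Suc n) (subtree T u) else subtree T u)"
    and "subtree (insert_child T v i (Suc n)) (Suc n) = {Suc n}"
proof -
  have leaf: "x = Suc n" if "(Suc n, x) \<in> (tree_edges T)\<^sup>*" for x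
    using that by (cases rule: converse_rtranclE) (use tree_edge_bounds[OF T] in fastforce)+
  have star: "(insert (v, Suc n) (tree_edges T))\<^sup>* =
      (tree_edges T)\<^sup>* \<union> {(x, y). (x, v) \<in> (tree_edges T)\<^sup>* \<and> (Suc n, y) \<in> (tree_edges T)\<^sup>*}"
    by (rule rtrancl_insert)
  show "subtree (insert_child T v i (Suc n)) u =
      (if v \<in> subtree T u then insert (Suc n) (subtree T u) else subtree T u)" if "u \<in> {1..n}"
    unfolding subtree_def tree_edges_insert_child star using leaf by auto
  have "(Suc n, v) \<notin> (tree_edges T)\<^sup>*" using leaf[of v] v by auto
  then show "subtree (insert_child T v i (Suc n)) (Suc n) = {Suc n}"
    unfolding subtree_def tree_edges_insert_child star using leaf by auto
qed

lemma depth_insert_child: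
  assumes v: "v \<in> {1..n}"
  shows "u \<in> {1..n} \<Longrightarrow> tree_dist (insert_child T v i (Suc n)) 1 u = tree_dist T 1 u"
    and "tree_dist (insert_child T v i (Suc n)) 1 (Suc n) = Suc (tree_dist T 1 v)"
proof -
  let ?S = "insert_child T v i (Suc n)"
  have S: "?S \<in> plane_increasing_trees (Suc n)" by (rule insert_child_in_trees[OF T v])
  have old: "u \<in> {1..n} \<Longrightarrow> tree_dist ?S 1 u = tree_dist T 1 u" for u
  proof (induction u rule: less_induct)
    case (less u)
    show ?case
    proof (cases "u = 1")
      case False
      then obtain p where p: "(p, u) \<in> tree_edges T" using parent_exists[OF T, of u] less.prems by force
      then have "(p, u) \<in> tree_edges ?S" by (simp add: tree_edges_insert_child)
      then show ?thesis
        using depth_edge[OF T p] depth_edge[OF S] less.IH[of p] tree_edge_bounds[OF T p] by simp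
    qed simp
  qed
  then show "u \<in> {1..n} \<Longrightarrow> tree_dist ?S 1 u = tree_dist T 1 u" .
  have "(v, Suc n) \<in> tree_edges ?S" by (simp add: tree_edges_insert_child)
  then show "tree_dist ?S 1 (Suc n) = Suc (tree_dist T 1 v)"
    using depth_edge[OF S] old[OF v] by simp
qed

end

section \<open>Averages over random trees\<close>

definition tree_avg :: "real \<Rightarrow> real \<Rightarrow> nat \<Rightarrow> (plane_tree \<Rightarrow> real) \<Rightarrow> real" where
  "tree_avg c1 c2 n f = (\<Sum>T\<in>plane_increasing_trees n. tree_weight c1 c2 n T * f T) /
     (\<Sum>T\<in>plane_increasing_trees n. tree_weight c1 c2 n T)"

lemma tree_avg_cong:
  "(\<And>T. T \<in> plane_increasing_trees n \<Longrightarrow> f T = g T) \<Longrightarrow> tree_avg c1 c2 n f = tree_avg c1 c2 n g"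
  unfolding tree_avg_def by (simp cong: sum.cong)

lemma tree_avg_add: "tree_avg c1 c2 n (\<lambda>T. f T + g T) = tree_avg c1 c2 n f + tree_avg c1 c2 n g"
  by (simp add: tree_avg_def distrib_left sum.distrib add_divide_distrib)

lemma tree_avg_cmult: "tree_avg c1 c2 n (\<lambda>T. c * f T) = c * tree_avg c1 c2 n f"
  by (simp add: tree_avg_def mult.left_commute sum_distrib_left)

lemma tree_avg_sum:
  "tree_avg c1 c2 n (\<lambda>T. \<Sum>i\<in>I. f i T) = (\<Sum>i\<in>I. tree_avg c1 c2 n (f i))"
proof -
  have "(\<Sum>T\<in>A. w T * (\<Sum>i\<in>I. f i T)) = (\<Sum>i\<in>I. \<Sum>T\<in>A. w T * f i T)" for A and w :: "plane_tree \<Rightarrow> real"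
    unfolding sum_distrib_left by (rule sum.swap)
  then show ?thesis by (simp add: tree_avg_def sum_divide_distrib)
qed

lemma tree_avg_const: "very_simple c1 c2 \<Longrightarrow> tree_avg c1 c2 n (\<lambda>_. c) = c"
  using total_weight_pos[of c1 c2 n] by (simp add: tree_avg_def sum_distrib_right[symmetric])

text \<open>
  One step of the growth process: a statistic of the larger tree is averaged over the node that
  receives the new leaf.
\<close>

lemma tree_avg_Suc:
  assumes vs: "very_simple c1 c2" and n: "n \<ge> 1"
    and f: "\<And>T v i. T \<in> plane_increasing_trees n \<Longrightarrow> v \<in> {1..n} \<Longrightarrow> f (insert_child T v i (Suc n)) = F T v"
  shows "(real n + tree_alpha c1 c2 - 1) * tree_avg c1 c2 (Suc n) f =
    tree_avg c1 c2 n (\<lambda>T. \<Sum>v\<in>{1..n}. node_weight (tree_alpha c1 c2) T v * F T v)"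
proof -
  let ?a = "tree_alpha c1 c2"
  let ?W = "\<lambda>n. \<Sum>T\<in>plane_increasing_trees n. tree_weight c1 c2 n T"
  have c1: "c1 > 0" and a: "?a > 0" using vs by (auto simp: very_simple_def)
  have "?W (Suc n) = c1 * (\<Sum>T\<in>plane_increasing_trees n. tree_weight c1 c2 n T * (real n + ?a - 1))"
    using weighted_sum_trees_Suc[OF c1 n, of "\<lambda>_. 1" "\<lambda>_ _. 1" c2] sum_node_weight_all[OF _ n]
    by (simp cong: sum.cong)
  then have W: "?W (Suc n) = c1 * (real n + ?a - 1) * ?W n"
    by (simp add: sum_distrib_right mult_ac)
  have pos: "real n + ?a - 1 > 0" using n a by (simp add: add_pos_nonneg)
  have "(\<Sum>S\<in>plane_increasing_trees (Suc n). tree_weight c1 c2 (Suc n) S * f S) =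
      c1 * (\<Sum>T\<in>plane_increasing_trees n. tree_weight c1 c2 n T *
        (\<Sum>v\<in>{1..n}. node_weight ?a T v * F T v))" (is "_ = c1 * ?X")
    by (rule weighted_sum_trees_Suc[where f = f and F = F, OF c1 n f])
  then have "tree_avg c1 c2 (Suc n) f = (c1 * ?X) / (c1 * (real n + ?a - 1) * ?W n)"
    by (simp only: tree_avg_def W)
  also have "(real n + ?a - 1) * \<dots> = ?X / ?W n"
    using c1 pos total_weight_pos[OF vs, of n] by simp
  finally show ?thesis by (simp only: tree_avg_def)
qed

section \<open>Nodes of given depth and subtree size\<close>

lemma sum_1_Suc: "(\<Sum>u\<in>{1..Suc n}. f u) = (\<Sum>u\<in>{1..n}. f u) + (f (Suc n) :: real)"
  by simp

definition census :: "nat \<Rightarrow> nat \<Rightarrow> nat \<Rightarrow> plane_tree \<Rightarrow> real" where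
  "census n h s T = (\<Sum>u\<in>{1..n}. of_bool (tree_dist T 1 u = h \<and> card (subtree T u) = s))"

text \<open>
  Up to normalisation, the probability that the next leaf gets depth \<open>h + 1\<close>. It is the source
  term in the recursion for the census of nodes with subtree size 1.
\<close>

definition layer_weight :: "real \<Rightarrow> nat \<Rightarrow> nat \<Rightarrow> plane_tree \<Rightarrow> real" where
  "layer_weight \<alpha> n h T = (\<Sum>v\<in>{1..n}. node_weight \<alpha> T v * of_bool (tree_dist T 1 v = h))"

definition layer_size :: "nat \<Rightarrow> nat \<Rightarrow> plane_tree \<Rightarrow> real" where
  "layer_size n h T = (\<Sum>v\<in>{1..n}. of_bool (tree_dist T 1 v = h))"

text \<open>
  The children of the nodes at depth \<open>h\<close> are the nodes at depth \<open>h + 1\<close>.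
\<close>

lemma layer_weight_eq:
  assumes T: "T \<in> plane_increasing_trees n"
  shows "layer_weight \<alpha> n h T = \<alpha> * layer_size n h T - (\<alpha> - 1) * layer_size n (Suc h) T"
proof -
  have size: "layer_size n h T = real (card {v \<in> {1..n}. tree_dist T 1 v = h})" for h
    by (simp add: layer_size_def Int_def)
  have "layer_weight \<alpha> n h T = (\<Sum>v\<in>{v \<in> {1..n}. tree_dist T 1 v = h}. node_weight \<alpha> T v)"
    unfolding layer_weight_def by (rule sum.mono_neutral_cong_right) auto
  also have "\<dots> = \<alpha> * layer_size n h T - (\<alpha> - 1) * layer_size n (Suc h) T"
    by (subst sum_node_weight[OF T]) (simp_all only: children_of_layer[OF T] size, simp)
  finally show ?thesis .
qed

lemma layer_size_insert_child:
  assumes T: "T \<in> plane_increasing_trees n" and v: "v \<in> {1..n}"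
  shows "layer_size (Suc n) h (insert_child T v i (Suc n)) =
    layer_size n h T + of_bool (Suc (tree_dist T 1 v) = h)"
proof -
  have "(\<Sum>u\<in>{1..n}. of_bool (tree_dist (insert_child T v i (Suc n)) 1 u = h)) = layer_size n h T"
    unfolding layer_size_def by (intro sum.cong refl) (simp only: depth_insert_child(1)[OF T v])
  then show ?thesis
    unfolding layer_size_def[of "Suc n"] sum_1_Suc depth_insert_child(2)[OF T v] by simp
qed

lemma sum_node_weight_layer_weight_insert:
  assumes T: "T \<in> plane_increasing_trees n" and n: "n \<ge> 1"
  shows "(\<Sum>v\<in>{1..n}. node_weight \<alpha> T v *
      (layer_weight \<alpha> n h T + \<alpha> * of_bool (Suc (tree_dist T 1 v) = h) - (\<alpha> - 1) * of_bool (tree_dist T 1 v = h)))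
    = real n * layer_weight \<alpha> n h T + \<alpha> * (case h of 0 \<Rightarrow> 0 | Suc k \<Rightarrow> layer_weight \<alpha> n k T)"
proof -
  have prev: "(\<Sum>v\<in>{1..n}. node_weight \<alpha> T v * of_bool (Suc (tree_dist T 1 v) = h)) =
      (case h of 0 \<Rightarrow> 0 | Suc k \<Rightarrow> layer_weight \<alpha> n k T)"
    by (cases h) (simp_all add: layer_weight_def)
  have "(\<Sum>v\<in>{1..n}. node_weight \<alpha> T v *
      (layer_weight \<alpha> n h T + \<alpha> * of_bool (Suc (tree_dist T 1 v) = h) - (\<alpha> - 1) * of_bool (tree_dist T 1 v = h)))
    = (\<Sum>v\<in>{1..n}. node_weight \<alpha> T v) * layer_weight \<alpha> n h T
      + \<alpha> * (\<Sum>v\<in>{1..n}. node_weight \<alpha> T v * of_bool (Suc (tree_dist T 1 v) = h))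
      - (\<alpha> - 1) * (\<Sum>v\<in>{1..n}. node_weight \<alpha> T v * of_bool (tree_dist T 1 v = h))"
    unfolding sum_distrib_right sum_distrib_left sum.distrib[symmetric] sum_subtractf[symmetric]
    by (intro sum.cong refl) (simp add: algebra_simps)
  also have "\<dots> = (real n + \<alpha> - 1) * layer_weight \<alpha> n h T
      + \<alpha> * (case h of 0 \<Rightarrow> 0 | Suc k \<Rightarrow> layer_weight \<alpha> n k T) - (\<alpha> - 1) * layer_weight \<alpha> n h T"
    unfolding sum_node_weight_all[OF T n] prev by (simp only: layer_weight_def)
  finally show ?thesis by (simp add: algebra_simps)
qed

lemma tree_avg_layer_weight_Suc:
  assumes vs: "very_simple c1 c2" and n: "n \<ge> 1"
  defines "\<alpha> \<equiv> tree_alpha c1 c2"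
  shows "(real n + \<alpha> - 1) * tree_avg c1 c2 (Suc n) (layer_weight \<alpha> (Suc n) h) =
    real n * tree_avg c1 c2 n (layer_weight \<alpha> n h)
    + \<alpha> * (case h of 0 \<Rightarrow> 0 | Suc k \<Rightarrow> tree_avg c1 c2 n (layer_weight \<alpha> n k))"
proof -
  have "layer_weight \<alpha> (Suc n) h (insert_child T v i (Suc n)) = layer_weight \<alpha> n h T
      + \<alpha> * of_bool (Suc (tree_dist T 1 v) = h) - (\<alpha> - 1) * of_bool (tree_dist T 1 v = h)"
    if T: "T \<in> plane_increasing_trees n" and v: "v \<in> {1..n}" for T v i
    unfolding layer_weight_eq[OF insert_child_in_trees[OF T v]] layer_weight_eq[OF T]
      layer_size_insert_child[OF T v] by (simp add: algebra_simps)
  from tree_avg_Suc[where F = "\<lambda>T v. layer_weight \<alpha> n h T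
      + \<alpha> * of_bool (Suc (tree_dist T 1 v) = h) - (\<alpha> - 1) * of_bool (tree_dist T 1 v = h)", OF vs n this]
  have "(real n + \<alpha> - 1) * tree_avg c1 c2 (Suc n) (layer_weight \<alpha> (Suc n) h) =
      tree_avg c1 c2 n (\<lambda>T. real n * layer_weight \<alpha> n h T + \<alpha> * (case h of 0 \<Rightarrow> 0 | Suc k \<Rightarrow> layer_weight \<alpha> n k T))"
    unfolding \<alpha>_def[symmetric]
    by (simp only: sum_node_weight_layer_weight_insert[OF _ n] cong: tree_avg_cong)
  also have "\<dots> = real n * tree_avg c1 c2 n (layer_weight \<alpha> n h)
    + \<alpha> * (case h of 0 \<Rightarrow> 0 | Suc k \<Rightarrow> tree_avg c1 c2 n (layer_weight \<alpha> n k))"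
    unfolding tree_avg_add tree_avg_cmult
    using tree_avg_const[OF vs, of n 0] by (cases h) simp_all
  finally show ?thesis .
qed

lemma card_subtree_pos:
  "T \<in> plane_increasing_trees n \<Longrightarrow> u \<in> {1..n} \<Longrightarrow> card (subtree T u) \<ge> 1"
  using finite_subtree subtree_self by (metis One_nat_def Suc_leI card_gt_0_iff empty_iff)

lemma census_insert_child:
  assumes T: "T \<in> plane_increasing_trees n" and v: "v \<in> {1..n}"
  shows "census (Suc n) h s (insert_child T v i (Suc n)) =
    (\<Sum>u\<in>{1..n}. of_bool (tree_dist T 1 u = h \<and> card (subtree T u) + of_bool (v \<in> subtree T u) = s))
    + of_bool (Suc (tree_dist T 1 v) = h \<and> s = 1)"
proof -
  let ?S = "insert_child T v i (Suc n)"
  have "card (subtree ?S u) = card (subtree T u) + of_bool (v \<in> subtree T u)" if u: "u \<in> {1..n}" for u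
  proof -
    have "Suc n \<notin> subtree T u" using subtree_bounds[OF T, of "Suc n" u] u by auto
    then show ?thesis using finite_subtree[OF T u] subtree_insert_child(1)[OF T v u] by simp
  qed
  then have "(\<Sum>u\<in>{1..n}. of_bool (tree_dist ?S 1 u = h \<and> card (subtree ?S u) = s)) =
      (\<Sum>u\<in>{1..n}. of_bool (tree_dist T 1 u = h \<and> card (subtree T u) + of_bool (v \<in> subtree T u) = s) :: real)"
    by (intro sum.cong refl) (simp only: depth_insert_child(1)[OF T v])
  moreover have "card (subtree ?S (Suc n)) = 1" using subtree_insert_child(2)[OF T v] by simp
  ultimately show ?thesis
    unfolding census_def sum_1_Suc depth_insert_child(2)[OF T v] by (simp add: eq_commute[of s])
qed

text \<open>
  Split the attachment points according to whether they lie below a given node \<open>u\<close>: with weight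
  \<open>card (subtree T u) + \<alpha> - 1\<close> the subtree of \<open>u\<close> grows by one, and with the remaining weight
  \<open>n - card (subtree T u)\<close> it stays as it is. The last term counts the new leaf itself.
\<close>

lemma sum_node_weight_census_insert:
  assumes T: "T \<in> plane_increasing_trees n" and n: "n \<ge> 1"
  shows "(\<Sum>v\<in>{1..n}. node_weight \<alpha> T v * census (Suc n) (Suc k) (Suc t) (insert_child T v i (Suc n)))
    = (real t + \<alpha> - 1) * census n (Suc k) t T + (real n - real (Suc t)) * census n (Suc k) (Suc t) T
      + of_bool (t = 0) * layer_weight \<alpha> n k T"
proof -
  let ?sz = "\<lambda>u. card (subtree T u)"
  let ?w = "node_weight \<alpha> T"
  have inner: "(\<Sum>v\<in>{1..n}. ?w v * of_bool (?sz u + of_bool (v \<in> subtree T u) = Suc t)) =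
      (real t + \<alpha> - 1) * of_bool (?sz u = t) + (real n - real (Suc t)) * of_bool (?sz u = Suc t)"
    if u: "u \<in> {1..n}" for u
  proof -
    let ?U = "subtree T u"
    have sub: "?U \<subseteq> {1..n}" using subtree_bounds[OF T] u by blast
    have "(\<Sum>v\<in>{1..n}. ?w v * of_bool (?sz u + of_bool (v \<in> ?U) = Suc t)) =
        (\<Sum>v\<in>{1..n} - ?U. ?w v * of_bool (?sz u = Suc t)) + (\<Sum>v\<in>?U. ?w v * of_bool (?sz u = t))"
      by (subst sum.subset_diff[OF sub]) (auto intro!: arg_cong2[of _ _ _ _ "(+)"] sum.cong)
    also have "\<dots> = (\<Sum>v\<in>{1..n} - ?U. ?w v) * of_bool (?sz u = Suc t) + (\<Sum>v\<in>?U. ?w v) * of_bool (?sz u = t)"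
      by (simp only: sum_distrib_right)
    also have "(\<Sum>v\<in>{1..n} - ?U. ?w v) = real n - real (?sz u)"
      using sum.subset_diff[OF sub, of ?w] sum_node_weight_all[OF T n, of \<alpha>] sum_node_weight_subtree[OF T u, of \<alpha>]
      by simp
    also have "(\<Sum>v\<in>?U. ?w v) = real (?sz u) + \<alpha> - 1" by (rule sum_node_weight_subtree[OF T u])
    finally show ?thesis by auto
  qed
  have "(\<Sum>v\<in>{1..n}. ?w v * census (Suc n) (Suc k) (Suc t) (insert_child T v i (Suc n))) =
      (\<Sum>v\<in>{1..n}. \<Sum>u\<in>{1..n}. ?w v * of_bool (tree_dist T 1 u = Suc k \<and> ?sz u + of_bool (v \<in> subtree T u) = Suc t))
      + (\<Sum>v\<in>{1..n}. ?w v * of_bool (tree_dist T 1 v = k \<and> t = 0))"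
    unfolding sum.distrib[symmetric]
    by (intro sum.cong refl)
      (simp only: census_insert_child[OF T] distrib_left sum_distrib_left nat.inject One_nat_def)
  also have "(\<Sum>v\<in>{1..n}. \<Sum>u\<in>{1..n}. ?w v * of_bool (tree_dist T 1 u = Suc k \<and> ?sz u + of_bool (v \<in> subtree T u) = Suc t))
      = (\<Sum>u\<in>{1..n}. of_bool (tree_dist T 1 u = Suc k) *
          (\<Sum>v\<in>{1..n}. ?w v * of_bool (?sz u + of_bool (v \<in> subtree T u) = Suc t)))"
    unfolding sum_distrib_left
    by (subst sum.swap, intro sum.cong refl) (simp only: of_bool_conj mult_ac)
  also have "\<dots> = (\<Sum>u\<in>{1..n}. of_bool (tree_dist T 1 u = Suc k) *
      ((real t + \<alpha> - 1) * of_bool (?sz u = t) + (real n - real (Suc t)) * of_bool (?sz u = Suc t)))"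
    by (intro sum.cong refl) (simp only: inner)
  also have "\<dots> = (real t + \<alpha> - 1) * census n (Suc k) t T + (real n - real (Suc t)) * census n (Suc k) (Suc t) T"
    unfolding census_def sum_distrib_left sum.distrib[symmetric]
    by (intro sum.cong refl) (simp only: of_bool_conj algebra_simps)
  also have "(\<Sum>v\<in>{1..n}. ?w v * of_bool (tree_dist T 1 v = k \<and> t = 0)) = of_bool (t = 0) * layer_weight \<alpha> n k T"
    by (simp add: layer_weight_def)
  finally show ?thesis .
qed

lemma tree_avg_census_Suc:
  assumes vs: "very_simple c1 c2" and n: "n \<ge> 1"
  defines "\<alpha> \<equiv> tree_alpha c1 c2"
  shows "(real n + \<alpha> - 1) * tree_avg c1 c2 (Suc n) (census (Suc n) (Suc k) (Suc t)) =
    (real t + \<alpha> - 1) * tree_avg c1 c2 n (census n (Suc k) t)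
    + (real n - real (Suc t)) * tree_avg c1 c2 n (census n (Suc k) (Suc t))
    + of_bool (t = 0) * tree_avg c1 c2 n (layer_weight \<alpha> n k)"
proof -
  have "census (Suc n) (Suc k) (Suc t) (insert_child T v i (Suc n)) =
      census (Suc n) (Suc k) (Suc t) (insert_child T v 0 (Suc n))"
    if "T \<in> plane_increasing_trees n" "v \<in> {1..n}" for T v i
    using census_insert_child[OF that] by simp
  from tree_avg_Suc[where F = "\<lambda>T v. census (Suc n) (Suc k) (Suc t) (insert_child T v 0 (Suc n))", OF vs n this] show ?thesis
    unfolding \<alpha>_def[symmetric]
    by (simp only: sum_node_weight_census_insert[OF _ n] tree_avg_add tree_avg_cmult cong: tree_avg_cong)
qed

section \<open>Closed form of the expected census\<close>

text \<open>
  The elementary symmetric polynomial of degree \<open>k\<close> in \<open>1 / N, \<dots>, 1 / (n - 1)\<close>, as a coefficient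
  of a product of linear factors. In this form removing the largest or the smallest index is
  immediate.
\<close>

definition harmonic_esym :: "nat \<Rightarrow> nat \<Rightarrow> nat \<Rightarrow> real" where
  "harmonic_esym N n k = poly.coeff (\<Prod>j\<in>{N..<n}. [:1, 1 / real j:]) k"

lemma harmonic_esym_empty [simp]: "harmonic_esym n n k = of_bool (k = 0)"
  by (simp add: harmonic_esym_def)

lemma coeff_mult_linear:
  "poly.coeff (p * [:1, a:]) k = poly.coeff p k + a * (case k of 0 \<Rightarrow> 0 | Suc j \<Rightarrow> poly.coeff p j)"
  for a :: real
  by (cases k) (simp_all add: mult.commute[of p])

lemma harmonic_esym_top:
  "N \<le> n \<Longrightarrow> harmonic_esym N (Suc n) k =
    harmonic_esym N n k + (case k of 0 \<Rightarrow> 0 | Suc j \<Rightarrow> harmonic_esym N n j) / real n"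
  unfolding harmonic_esym_def prod.atLeastLessThan_Suc coeff_mult_linear by (cases k) simp_all

lemma harmonic_esym_bottom:
  assumes "N < n"
  shows "harmonic_esym N n k =
    harmonic_esym (Suc N) n k + (case k of 0 \<Rightarrow> 0 | Suc j \<Rightarrow> harmonic_esym (Suc N) n j) / real N"
  unfolding harmonic_esym_def prod.atLeast_Suc_lessThan[OF assms]
  by (subst mult.commute, subst coeff_mult_linear) (cases k; simp)

text \<open>
  For \<open>n \<ge> 1\<close>, all trees of size \<open>n\<close> together have weight
  \<open>c1 ^ (n - 1) * fact (n - 1) * growth \<alpha> n\<close>; the remaining factor behaves like a constant multiple
  of \<open>n powr (\<alpha> - 1)\<close>.
\<close>

definition growth :: "real \<Rightarrow> nat \<Rightarrow> real" where
  "growth \<alpha> n = pochhammer \<alpha> (n - 1) / fact (n - 1)"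

lemma growth_1 [simp]: "growth \<alpha> 1 = 1" "growth \<alpha> (Suc 0) = 1"
  by (simp_all add: growth_def)

lemma growth_Suc:
  assumes "n \<ge> 1"
  shows "real n * growth \<alpha> (Suc n) = (real n + \<alpha> - 1) * growth \<alpha> n"
proof -
  obtain m where m: "n = Suc m" using assms by (cases n) auto
  have "real (Suc m) * (pochhammer \<alpha> (Suc m) / fact (Suc m)) = pochhammer \<alpha> (Suc m) / fact m"
    by (simp add: divide_simps)
  then show ?thesis by (simp add: m growth_def pochhammer_Suc mult.commute add.commute)
qed

lemma growth_pos: "\<alpha> > 0 \<Longrightarrow> growth \<alpha> n > 0"
  by (simp add: growth_def pochhammer_pos)

lemma tree_1_children: "T \<in> plane_increasing_trees (Suc 0) \<Longrightarrow> T v = []"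
  using children_bounds[of T "Suc 0" _ v] by (cases "T v") fastforce+

text \<open>
  The recursion of the expected layer weights is, after multiplication by \<open>growth \<alpha> n\<close> and
  division by \<open>\<alpha> ^ Suc k\<close>, the recursion of \<open>harmonic_esym\<close> in its upper index.
\<close>

lemma tree_avg_layer_weight:
  assumes vs: "very_simple c1 c2" and n: "n \<ge> 1"
  defines "\<alpha> \<equiv> tree_alpha c1 c2"
  shows "tree_avg c1 c2 n (layer_weight \<alpha> n k) = \<alpha> ^ Suc k * harmonic_esym 1 n k / growth \<alpha> n"
  using n
proof (induction n arbitrary: k rule: nat_induct_at_least)
  case base
  have "tree_avg c1 c2 1 (layer_weight \<alpha> 1 k) = tree_avg c1 c2 1 (\<lambda>_. \<alpha> * of_bool (k = 0))"
    by (rule tree_avg_cong) (auto simp: layer_weight_def node_weight_def tree_1_children)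
  then show ?case using tree_avg_const[OF vs] by (cases k) simp_all
next
  case (Suc n)
  have a: "\<alpha> > 0" using vs by (simp add: very_simple_def \<alpha>_def)
  define G where "G = growth \<alpha> n"
  have G: "G > 0" unfolding G_def by (rule growth_pos[OF a])
  have pos: "real n + \<alpha> - 1 > 0" using Suc.hyps a by (simp add: add_pos_nonneg)
  have n0: "real n > 0" using Suc.hyps by simp
  have G': "growth \<alpha> (Suc n) = (real n + \<alpha> - 1) * G / real n"
    using growth_Suc[OF Suc.hyps, of \<alpha>] n0 by (simp add: G_def field_simps)
  have "real n * harmonic_esym 1 (Suc n) k =
      real n * harmonic_esym 1 n k + (case k of 0 \<Rightarrow> 0 | Suc j \<Rightarrow> harmonic_esym 1 n j)"
    unfolding harmonic_esym_top[OF Suc.hyps] using n0 by (simp add: distrib_left)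
  then have "(real n + \<alpha> - 1) * tree_avg c1 c2 (Suc n) (layer_weight \<alpha> (Suc n) k) =
      \<alpha> ^ Suc k * (real n * harmonic_esym 1 (Suc n) k) / G"
    using tree_avg_layer_weight_Suc[OF vs Suc.hyps, of k] G
    unfolding \<alpha>_def[symmetric]
    by (cases k) (use n0 in \<open>auto simp: Suc.IH G_def[symmetric] field_simps\<close>)
  moreover define p where "p = real n + \<alpha> - 1"
  ultimately have "p * tree_avg c1 c2 (Suc n) (layer_weight \<alpha> (Suc n) k) =
      \<alpha> ^ Suc k * (real n * harmonic_esym 1 (Suc n) k) / G"
    by simp
  moreover have "p > 0" using pos by (simp add: p_def)
  ultimately show ?case unfolding G' p_def[symmetric] using G n0 by (simp add: field_simps)
qed

lemma depth_pos_subtree_less: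
  assumes T: "T \<in> plane_increasing_trees n" and u: "u \<in> {1..n}" and d: "tree_dist T 1 u = Suc k"
  shows "card (subtree T u) < n"
proof -
  have "u \<noteq> 1" using d by auto
  then have "1 \<notin> subtree T u" using subtree_le[OF T, of 1 u] u by auto
  moreover have "subtree T u \<subseteq> {1..n}" using subtree_bounds[OF T] u by blast
  moreover have "1 \<in> {1..n}" using u by auto
  ultimately have "subtree T u \<subset> {1..n}" by blast
  then have "card (subtree T u) < card {1..n}" by (intro psubset_card_mono) auto
  then show ?thesis by simp
qed

lemma census_positive_depth_full:
  assumes T: "T \<in> plane_increasing_trees n"
  shows "census n (Suc k) n T = 0" "census n (Suc k) 0 T = 0"
  unfolding census_def using depth_pos_subtree_less[OF T] card_subtree_pos[OF T]
  by (force intro!: sum.neutral)+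

text \<open>
  The closed form solves the recursion \<open>tree_avg_census_Suc\<close>. Subtree size 1 is fed by the layer
  weights, whose closed form is what the inflow into size \<open>s\<close> from size \<open>s - 1\<close> would give for \<open>s = 1\<close>; so
  the inflow has the same shape for all \<open>s\<close>. Size \<open>n\<close> is excluded, because only the
  root has a subtree of that size.
\<close>

lemma tree_avg_census:
  assumes vs: "very_simple c1 c2" and s: "1 \<le> s" "s < n"
  defines "\<alpha> \<equiv> tree_alpha c1 c2"
  shows "tree_avg c1 c2 n (census n (Suc k) s) =
    \<alpha> ^ Suc k * growth \<alpha> s * harmonic_esym (Suc s) n k / (real s * growth \<alpha> n)"
  using s(2,1)
proof (induction n arbitrary: s k)
  case (Suc n)
  have n: "n \<ge> 1" using Suc.prems by simp
  have a: "\<alpha> > 0" using vs by (simp add: very_simple_def \<alpha>_def)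
  define G where "G = growth \<alpha> n"
  have G: "G > 0" unfolding G_def by (rule growth_pos[OF a])
  have n0: "real n > 0" using n by simp
  have G': "growth \<alpha> (Suc n) = (real n + \<alpha> - 1) * G / real n"
    using growth_Suc[OF n, of \<alpha>] n0 by (simp add: G_def field_simps)
  define p where "p = real n + \<alpha> - 1"
  have p_pos: "p > 0" using n a by (simp add: p_def add_pos_nonneg)
  obtain t where t: "s = Suc t" using Suc.prems by (cases s) auto
  define E where "E j = harmonic_esym (Suc s) n j" for j
  define E' where "E' = (case k of 0 \<Rightarrow> 0 | Suc j \<Rightarrow> E j)"
  define g where "g = growth \<alpha> s"
  have same: "(real n - real s) * tree_avg c1 c2 n (census n (Suc k) s) =
      (real n - real s) * (\<alpha> ^ Suc k * g * E k / (real s * G))"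
  proof (cases "s = n")
    case False
    then show ?thesis using Suc.IH[of s k] Suc.prems by (simp add: E_def g_def G_def)
  qed simp
  have low: "(real t + \<alpha> - 1) * tree_avg c1 c2 n (census n (Suc k) t)
      + of_bool (t = 0) * tree_avg c1 c2 n (layer_weight \<alpha> n k) = \<alpha> ^ Suc k * g * harmonic_esym s n k / G"
  proof (cases "t = 0")
    case True
    have "tree_avg c1 c2 n (census n (Suc k) 0) = 0"
      using census_positive_depth_full(2) tree_avg_const[OF vs, of n 0] by (simp cong: tree_avg_cong)
    then show ?thesis
      using True t tree_avg_layer_weight[OF vs n, of k] by (simp add: \<alpha>_def[symmetric] G_def g_def)
  next
    case False
    have gt: "real t * g = (real t + \<alpha> - 1) * growth \<alpha> t"
      using growth_Suc[of t \<alpha>] False by (simp add: g_def t)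
    have "(real t + \<alpha> - 1) * tree_avg c1 c2 n (census n (Suc k) t) =
        \<alpha> ^ Suc k * ((real t + \<alpha> - 1) * growth \<alpha> t) * harmonic_esym s n k / (real t * G)"
      using Suc.IH[of t k] Suc.prems False t by (simp add: G_def)
    also have "\<dots> = \<alpha> ^ Suc k * g * harmonic_esym s n k / G"
      unfolding gt[symmetric] using False by simp
    finally show ?thesis using False by simp
  qed
  have "s \<le> n" using Suc.prems by simp
  have esym_s: "harmonic_esym s n k = (if s = n then of_bool (k = 0) else E k + E' / real s)"
    using harmonic_esym_bottom[of s n k] \<open>s \<le> n\<close> by (auto simp: E_def E'_def split: nat.splits)
  have esym_n: "harmonic_esym (Suc s) (Suc n) k = (if s = n then of_bool (k = 0) else E k + E' / real n)"
    using harmonic_esym_top[of "Suc s" n k] \<open>s \<le> n\<close> by (auto simp: E_def E'_def split: nat.splits)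
  have "(real n + \<alpha> - 1) * tree_avg c1 c2 (Suc n) (census (Suc n) (Suc k) s) =
      \<alpha> ^ Suc k * g * harmonic_esym s n k / G + (real n - real s) * (\<alpha> ^ Suc k * g * E k / (real s * G))"
    using tree_avg_census_Suc[OF vs n, of k t] low same
    unfolding \<alpha>_def[symmetric] t[symmetric] by simp
  also have "\<dots> = \<alpha> ^ Suc k * g * (harmonic_esym s n k + (real n - real s) / real s * E k) / G"
    by (simp add: algebra_simps add_divide_distrib)
  also have "harmonic_esym s n k + (real n - real s) / real s * E k =
      real n * harmonic_esym (Suc s) (Suc n) k / real s"
    unfolding esym_s esym_n using n0 Suc.prems by (simp add: field_simps)
  finally have "p * tree_avg c1 c2 (Suc n) (census (Suc n) (Suc k) s) =
      \<alpha> ^ Suc k * g * (real n * harmonic_esym (Suc s) (Suc n) k / real s) / G"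
    by (simp only: p_def)
  then show ?case
    unfolding G' g_def[symmetric] p_def[symmetric] using p_pos G n0 Suc.prems by (simp add: field_simps)
qed simp

section \<open>Exact distribution of the centroid depth\<close>

definition depth_tail :: "real \<Rightarrow> real \<Rightarrow> nat \<Rightarrow> nat \<Rightarrow> real" where
  "depth_tail c1 c2 n h = tree_avg c1 c2 n (\<lambda>T. of_bool (h \<le> centroid_depth n T))"

lemma sum_census:
  assumes T: "T \<in> plane_increasing_trees n" and n: "n \<ge> 1"
  shows "(\<Sum>s\<in>{Suc (n div 2)..n}. census n h s T) = of_bool (h \<le> centroid_depth n T)"
proof -
  let ?d = "tree_dist T 1"
  have "(\<Sum>s\<in>{Suc (n div 2)..n}. of_bool (?d u = h \<and> card (subtree T u) = s)) =
      (of_bool (?d u = h \<and> n div 2 < card (subtree T u)) :: real)" if u: "u \<in> {1..n}" for u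
  proof -
    have "card (subtree T u) \<le> card {1..n}"
      by (rule card_mono) (use subtree_bounds[OF T] u in blast)+
    then have "card (subtree T u) \<in> {Suc (n div 2)..n} \<longleftrightarrow> n div 2 < card (subtree T u)" by auto
    moreover have "(\<Sum>s\<in>{Suc (n div 2)..n}. of_bool (?d u = h \<and> card (subtree T u) = s)) =
        (\<Sum>s\<in>{Suc (n div 2)..n}. if card (subtree T u) = s then of_bool (?d u = h) else 0 :: real)"
      by (intro sum.cong refl) auto
    ultimately show ?thesis unfolding sum.delta'[OF finite_atLeastAtMost] by auto
  qed
  then have "(\<Sum>s\<in>{Suc (n div 2)..n}. census n h s T) =
      (\<Sum>u\<in>{1..n}. of_bool (?d u = h \<and> n div 2 < card (subtree T u)))"
    unfolding census_def by (subst sum.swap) (intro sum.cong refl)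
  also have "\<dots> = real (card {u \<in> {1..n}. ?d u = h \<and> n div 2 < card (subtree T u)})"
    by (simp add: Int_def)
  also have "\<dots> = of_bool (h \<le> centroid_depth n T)"
    unfolding card_majority_at_depth[OF T n] by simp
  finally show ?thesis .
qed

lemma depth_tail_0: "very_simple c1 c2 \<Longrightarrow> depth_tail c1 c2 n 0 = 1"
  by (simp add: depth_tail_def tree_avg_const)

lemma depth_tail_Suc:
  assumes vs: "very_simple c1 c2" and n: "n \<ge> 1"
  defines "\<alpha> \<equiv> tree_alpha c1 c2"
  shows "depth_tail c1 c2 n (Suc k) = (\<Sum>s\<in>{Suc (n div 2)..<n}.
    \<alpha> ^ Suc k * growth \<alpha> s * harmonic_esym (Suc s) n k / (real s * growth \<alpha> n))"
proof -
  have "depth_tail c1 c2 n (Suc k) = tree_avg c1 c2 n (\<lambda>T. \<Sum>s\<in>{Suc (n div 2)..n}. census n (Suc k) s T)"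
    unfolding depth_tail_def by (rule tree_avg_cong) (simp only: sum_census[OF _ n])
  also have "\<dots> = (\<Sum>s\<in>{Suc (n div 2)..n}. tree_avg c1 c2 n (census n (Suc k) s))"
    by (rule tree_avg_sum)
  also have "{Suc (n div 2)..n} = insert n {Suc (n div 2)..<n}" using n by auto
  also have "(\<Sum>s\<in>insert n {Suc (n div 2)..<n}. tree_avg c1 c2 n (census n (Suc k) s)) =
      (\<Sum>s\<in>{Suc (n div 2)..<n}. tree_avg c1 c2 n (census n (Suc k) s))"
    using census_positive_depth_full(1) tree_avg_const[OF vs, of n 0] by (simp cong: tree_avg_cong)
  also have "\<dots> = (\<Sum>s\<in>{Suc (n div 2)..<n}.
    \<alpha> ^ Suc k * growth \<alpha> s * harmonic_esym (Suc s) n k / (real s * growth \<alpha> n))"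
    unfolding \<alpha>_def by (intro sum.cong refl tree_avg_census[OF vs]) auto
  finally show ?thesis .
qed

text \<open>
  \<open>S N h\<close> is the expected number of nodes of depth \<open>h\<close> with subtree size at least \<open>N\<close>. The
  combination on the left is chosen such that lowering \<open>N\<close> by one changes it by
  \<open>g N * e N - g (N + 1) * e (N + 1)\<close> up to a factor independent of \<open>N\<close>, where \<open>g\<close> is \<open>growth \<alpha>\<close>
  and \<open>e N\<close> is \<open>harmonic_esym N n h\<close>; so the sum over the sizes collapses.
\<close>

lemma growth_telescope:
  fixes \<alpha> :: real
  assumes N: "1 \<le> N" "N \<le> n" and a: "\<alpha> > 0"
  defines "S \<equiv> \<lambda>N h. case h of 0 \<Rightarrow> 1 | Suc k \<Rightarrow> (\<Sum>s\<in>{N..<n}.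
    \<alpha> ^ Suc k * growth \<alpha> s * harmonic_esym (Suc s) n k / (real s * growth \<alpha> n))"
  shows "\<alpha> * S N h - (\<alpha> - 1) * S N (Suc h) =
    \<alpha> ^ Suc h * (growth \<alpha> N / growth \<alpha> n) * harmonic_esym N n h"
  using N(2,1)
proof (induction rule: inc_induct)
  case base
  have "growth \<alpha> n \<noteq> 0" using growth_pos[OF a, of n] by simp
  then show ?case by (cases h) (simp_all add: S_def)
next
  case (step N)
  define G where "G = growth \<alpha> n"
  define g where "g = growth \<alpha> N"
  define E where "E j = harmonic_esym (Suc N) n j" for j
  have G: "G > 0" unfolding G_def by (rule growth_pos[OF a])
  have N0: "real N > 0" using step.prems by simp
  have g': "growth \<alpha> (Suc N) = (real N + \<alpha> - 1) * g / real N"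
    using growth_Suc[OF step.prems, of \<alpha>] N0 by (simp add: g_def field_simps)
  define x where "x = \<alpha> ^ h * g / (real N * G)"
  define E' where "E' = (case h of 0 \<Rightarrow> 0 | Suc j \<Rightarrow> E j)"
  have S_Suc: "S N (Suc k) = S (Suc N) (Suc k) + \<alpha> ^ Suc k * g * E k / (real N * G)" for k
    using step.hyps by (simp add: S_def sum.atLeast_Suc_lessThan G_def g_def E_def)
  have S: "S N h = S (Suc N) h + x * E'" "S N (Suc h) = S (Suc N) (Suc h) + \<alpha> * x * E h"
    using S_Suc[of h] S_Suc[of "h - 1"] by (cases h; simp add: x_def E'_def S_def)+
  have esym: "harmonic_esym N n h = E h + E' / real N"
    unfolding E_def E'_def by (rule harmonic_esym_bottom) (use step.hyps in simp)
  have "\<alpha> * S (Suc N) h - (\<alpha> - 1) * S (Suc N) (Suc h) = \<alpha> * x * (real N + \<alpha> - 1) * E h"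
    using step.IH N0 by (simp add: g' G_def[symmetric] E_def x_def mult_ac)
  moreover have "\<alpha> ^ Suc h * (g / G) * (E h + E' / real N) = \<alpha> * x * (real N * E h + E')"
    using N0 by (simp add: x_def distrib_left add_divide_distrib mult_ac)
  ultimately show ?case
    unfolding S esym G_def[symmetric] g_def[symmetric] by (simp add: algebra_simps)
qed

lemma depth_tail_recursion:
  assumes vs: "very_simple c1 c2" and n: "n \<ge> 1"
  defines "\<alpha> \<equiv> tree_alpha c1 c2" and "N \<equiv> Suc (n div 2)"
  shows "\<alpha> * depth_tail c1 c2 n h - (\<alpha> - 1) * depth_tail c1 c2 n (Suc h) =
    \<alpha> ^ Suc h * (growth \<alpha> N / growth \<alpha> n) * harmonic_esym N n h"
proof -
  have "\<alpha> > 0" using vs by (simp add: very_simple_def \<alpha>_def)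
  moreover have "1 \<le> N" "N \<le> n" using n by (auto simp: N_def)
  moreover have "depth_tail c1 c2 n h = (case h of 0 \<Rightarrow> 1 | Suc k \<Rightarrow> (\<Sum>s\<in>{N..<n}.
    \<alpha> ^ Suc k * growth \<alpha> s * harmonic_esym (Suc s) n k / (real s * growth \<alpha> n)))" for h
    using depth_tail_0[OF vs] depth_tail_Suc[OF vs n] by (cases h) (simp_all add: \<alpha>_def N_def)
  ultimately show ?thesis using growth_telescope[of N n \<alpha> h] by simp
qed

lemma tree_avg_mono:
  assumes "very_simple c1 c2" "\<And>T. T \<in> plane_increasing_trees n \<Longrightarrow> f T \<le> g T"
  shows "tree_avg c1 c2 n f \<le> tree_avg c1 c2 n g"
  unfolding tree_avg_def using assms tree_weight_nonneg[OF assms(1)] total_weight_pos[OF assms(1), of n]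
  by (intro divide_right_mono sum_mono mult_left_mono) auto

lemma depth_tail_nonneg: "very_simple c1 c2 \<Longrightarrow> depth_tail c1 c2 n h \<ge> 0"
  using tree_avg_mono[of c1 c2 n "\<lambda>_. 0"] tree_avg_const[of c1 c2 n 0] by (simp add: depth_tail_def)

lemma depth_tail_antimono: "very_simple c1 c2 \<Longrightarrow> depth_tail c1 c2 n (Suc h) \<le> depth_tail c1 c2 n h"
  unfolding depth_tail_def by (rule tree_avg_mono) auto

text \<open>
  The recursion can be solved for an upper bound without knowing the next tail probability: if
  \<open>\<alpha> \<ge> 1\<close>, replace it by the current one, which is at least as large; otherwise its coefficient has the
  sign that allows to drop it.
\<close>

lemma depth_tail_bound:
  assumes vs: "very_simple c1 c2" and n: "n \<ge> 1"
  defines "\<alpha> \<equiv> tree_alpha c1 c2" and "N \<equiv> Suc (n div 2)"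
  shows "depth_tail c1 c2 n h \<le> max 1 \<alpha> * (\<alpha> ^ h * (growth \<alpha> N / growth \<alpha> n) * harmonic_esym N n h)"
proof -
  have a: "\<alpha> > 0" using vs by (simp add: very_simple_def \<alpha>_def)
  let ?B = "\<alpha> ^ h * (growth \<alpha> N / growth \<alpha> n) * harmonic_esym N n h"
  have rec: "\<alpha> * depth_tail c1 c2 n h - (\<alpha> - 1) * depth_tail c1 c2 n (Suc h) = \<alpha> * ?B"
    using depth_tail_recursion[OF vs n, of h] by (simp add: \<alpha>_def N_def)
  show ?thesis
  proof (cases "\<alpha> \<ge> 1")
    case True
    have "(\<alpha> - 1) * depth_tail c1 c2 n (Suc h) \<le> (\<alpha> - 1) * depth_tail c1 c2 n h"
      using True depth_tail_antimono[OF vs] by (intro mult_left_mono) auto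
    then have "depth_tail c1 c2 n h \<le> \<alpha> * ?B" using rec by (simp add: algebra_simps)
    then show ?thesis using True by (simp add: max_def)
  next
    case False
    have "(\<alpha> - 1) * depth_tail c1 c2 n (Suc h) \<le> 0"
      using False depth_tail_nonneg[OF vs] by (intro mult_nonpos_nonneg) auto
    then have "\<alpha> * depth_tail c1 c2 n h \<le> \<alpha> * ?B" using rec by linarith
    then have "depth_tail c1 c2 n h \<le> ?B" using a by (simp only: mult_le_cancel_left_pos)
    then show ?thesis using False by (simp add: max_def)
  qed
qed

section \<open>Limits of the factors\<close>

lemma harmonic_esym_0 [simp]: "harmonic_esym N n 0 = 1"
  by (simp add: harmonic_esym_def poly_0_coeff_0[symmetric] poly_prod)

lemma harmonic_esym_nonneg: "N \<le> n \<Longrightarrow> harmonic_esym N n k \<ge> 0"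
proof (induction n arbitrary: k rule: dec_induct)
  case (step n)
  then show ?case by (cases k) (simp_all add: harmonic_esym_top)
qed simp

text \<open>
  A quantitative form of Newton's identity. The defect \<open>d n k\<close> is the sum over \<open>j\<close> of \<open>1 / j ^ 2\<close>
  times the symmetric polynomial of degree \<open>k - 1\<close> in the other variables, so it is nonnegative
  and, as \<open>1 / j \<le> 1 / N\<close>, of lower order than its two terms when \<open>N\<close> is large. Both bounds are proved together,
  because adding a variable mixes the defects of neighbouring degrees.
\<close>

lemma harmonic_esym_newton:
  assumes "1 \<le> N" "N \<le> n"
  defines "d \<equiv> \<lambda>n k. harmonic_esym N n 1 * harmonic_esym N n k - real (Suc k) * harmonic_esym N n (Suc k)"
  shows "0 \<le> d n k \<and> d n (Suc k) \<le> harmonic_esym N n 1 * harmonic_esym N n k / real N"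
  using assms(2)
proof (induction n arbitrary: k rule: dec_induct)
  case base
  then show ?case by (simp add: d_def)
next
  case (step n)
  define y where "y = 1 / real n"
  have y: "0 \<le> y" "y \<le> 1 / real N" using step.hyps assms(1) by (auto simp: y_def frac_le)
  define e where "e k = harmonic_esym N n k" for k
  have e: "e k \<ge> 0" for k unfolding e_def using step.hyps by (intro harmonic_esym_nonneg) simp
  have top: "harmonic_esym N (Suc n) (Suc k) = e (Suc k) + y * e k" for k
    using harmonic_esym_top[of N n "Suc k"] step.hyps by (simp add: e_def y_def)
  have e0: "e 0 = 1" by (simp add: e_def)
  have d0: "d n 0 = 0" for n by (simp add: d_def)
  have dn: "d n k = e 1 * e k - real (Suc k) * e (Suc k)" for k by (simp add: d_def e_def)
  have rec: "d (Suc n) (Suc k) = d n (Suc k) + y * d n k + y ^ 2 * e k" for k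
    unfolding dn using top[of k] top[of "Suc k"] top[of 0] e0
    by (simp add: d_def algebra_simps power2_eq_square)
  have lower: "0 \<le> d (Suc n) k" for k
    using step.IH y e by (cases k) (simp_all add: d0 rec)
  have upper: "d (Suc n) (Suc k) \<le> harmonic_esym N (Suc n) 1 * harmonic_esym N (Suc n) k / real N"
  proof -
    define M where "M = 1 / real N"
    have M: "y \<le> M" "0 \<le> M" using y by (auto simp: M_def)
    have up: "d n (Suc k) \<le> M * (e 1 * e k)" for k
      using step.IH by (simp add: M_def e_def)
    have p1: "harmonic_esym N (Suc n) 1 = e 1 + y" using top[of 0] e0 by simp
    have sq: "y ^ 2 * e k \<le> M * (y * e k)"
      unfolding power2_eq_square using M y e by (simp add: mult_right_mono mult_ac)
    have "d (Suc n) (Suc k) \<le> M * ((e 1 + y) * harmonic_esym N (Suc n) k)"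
    proof (cases k)
      case 0
      then show ?thesis using rec[of 0] up[of 0] sq by (simp add: d0 e0 algebra_simps)
    next
      case (Suc j)
      have "y * d n (Suc j) \<le> y * (M * (e 1 * e j))"
        using up y by (intro mult_left_mono) auto
      moreover have "0 \<le> M * (y * (y * e j))" using M y e by simp
      ultimately show ?thesis
        using rec[of k] up[of k] sq Suc by (simp add: top algebra_simps)
    qed
    then show ?thesis unfolding p1 by (simp add: M_def)
  qed
  show ?case using lower upper by simp
qed

lemma harmonic_esym_le:
  assumes "1 \<le> N" "N \<le> n"
  shows "harmonic_esym N n k \<le> harmonic_esym N n 1 ^ k / fact k"
proof (induction k)
  case (Suc k)
  let ?p = "harmonic_esym N n 1"
  have p: "?p \<ge> 0" using harmonic_esym_nonneg assms by simp
  have "real (Suc k) * harmonic_esym N n (Suc k) \<le> ?p * harmonic_esym N n k"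
    using harmonic_esym_newton[OF assms, of k] by simp
  also have "\<dots> \<le> ?p * (?p ^ k / fact k)" using Suc p by (intro mult_left_mono) auto
  finally have "harmonic_esym N n (Suc k) \<le> ?p * (?p ^ k / fact k) / real (Suc k)"
    by (simp add: pos_le_divide_eq mult_ac del: of_nat_Suc)
  then show ?case by (simp add: divide_divide_eq_left mult.commute)
qed simp

lemma harmonic_esym_1: "N \<le> n \<Longrightarrow> harmonic_esym (Suc N) (Suc n) 1 = harm n - harm N"
proof (induction n rule: dec_induct)
  case (step n)
  then show ?case using harmonic_esym_top[of "Suc N" "Suc n" 1]
    by (simp add: harm_Suc inverse_eq_divide)
qed simp

lemma half_ratio_tendsto: "(\<lambda>n. real (Suc n div 2) / real n) \<longlonglongrightarrow> 1 / 2"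
proof (rule tendsto_sandwich)
  show "\<forall>\<^sub>F n in sequentially. (1 / 2 :: real) \<le> real (Suc n div 2) / real n"
    using eventually_gt_at_top[of 0]
  proof eventually_elim
    case (elim n)
    have "n \<le> 2 * (Suc n div 2)" by linarith
    then have "real n \<le> 2 * real (Suc n div 2)" by linarith
    then show ?case using elim by (simp add: field_simps)
  qed
  show "\<forall>\<^sub>F n in sequentially. real (Suc n div 2) / real n \<le> 1 / 2 + 1 / 2 * inverse (real n)"
    using eventually_gt_at_top[of 0]
  proof eventually_elim
    case (elim n)
    have "2 * (Suc n div 2) \<le> Suc n" by linarith
    then have "2 * real (Suc n div 2) \<le> real n + 1" by linarith
    then show ?case using elim by (simp add: field_simps)
  qed
  show "(\<lambda>n. 1 / 2 + 1 / 2 * inverse (real n)) \<longlonglongrightarrow> 1 / 2"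
    using tendsto_add[OF tendsto_const[of "1/2"] tendsto_mult_right_zero[OF lim_inverse_n, of "1/2 :: real"]]
    by simp
qed simp

lemma half_at_top: "filterlim (\<lambda>n. Suc n div 2) at_top sequentially"
  unfolding filterlim_at_top
proof
  fix Z :: nat
  show "\<forall>\<^sub>F n in sequentially. Z \<le> Suc n div 2"
    using eventually_ge_at_top[of "2 * Z"] by eventually_elim linarith
qed

lemma harmonic_esym_1_tendsto:
  "(\<lambda>n. harmonic_esym (Suc (Suc n div 2)) (Suc n) 1) \<longlonglongrightarrow> ln 2"
proof -
  let ?c = "\<lambda>n. harm n - ln (real n) :: real"
  have c: "?c \<longlonglongrightarrow> euler_mascheroni" by (rule euler_mascheroni_LIMSEQ)
  have c': "(\<lambda>n. ?c (Suc n div 2)) \<longlonglongrightarrow> euler_mascheroni"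
    by (rule filterlim_compose[OF c half_at_top])
  have "(\<lambda>n. ?c n - ?c (Suc n div 2) - ln (real (Suc n div 2) / real n)) \<longlonglongrightarrow>
      euler_mascheroni - euler_mascheroni - ln (1 / 2)"
    by (intro tendsto_diff c c' tendsto_ln half_ratio_tendsto) simp
  also have "euler_mascheroni - euler_mascheroni - ln (1 / 2) = (ln 2 :: real)" by (simp add: ln_div)
  finally show ?thesis
  proof (rule Lim_transform_eventually)
    show "\<forall>\<^sub>F n in sequentially. ?c n - ?c (Suc n div 2) - ln (real (Suc n div 2) / real n) =
        harmonic_esym (Suc (Suc n div 2)) (Suc n) 1"
      using eventually_gt_at_top[of 0]
    proof eventually_elim
      case (elim n)
      have "Suc n div 2 > 0" "Suc n div 2 \<le> n" using elim by linarith+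
      then show ?case using elim by (simp add: harmonic_esym_1[unfolded One_nat_def] ln_div)
    qed
  qed
qed

text \<open>
  As the individual variables tend to 0, Newton's identity becomes
  \<open>(k + 1) * e (k + 1) = e 1 * e k\<close> in the limit, and \<open>e 1\<close> is a difference of harmonic numbers
  that tends to \<open>ln 2\<close>.
\<close>

lemma harmonic_esym_tendsto:
  "(\<lambda>n. harmonic_esym (Suc (Suc n div 2)) (Suc n) k) \<longlonglongrightarrow> ln 2 ^ k / fact k"
proof (induction k rule: less_induct)
  case (less k)
  let ?e = "\<lambda>k n. harmonic_esym (Suc (Suc n div 2)) (Suc n) k"
  have e1: "?e 1 \<longlonglongrightarrow> ln 2" by (rule harmonic_esym_1_tendsto)
  consider "k = 0" | "k = 1" | j where "k = Suc (Suc j)" by (metis One_nat_def not0_implies_Suc)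
  then show ?case
  proof cases
    case 3
    let ?d = "\<lambda>n. ?e 1 n * ?e (Suc j) n - real (Suc (Suc j)) * ?e (Suc (Suc j)) n"
    have ej: "?e j \<longlonglongrightarrow> ln 2 ^ j / fact j" and ej': "?e (Suc j) \<longlonglongrightarrow> ln 2 ^ Suc j / fact (Suc j)"
      using less.IH[of j] less.IH[of "Suc j"] 3 by simp_all
    have newton: "0 \<le> ?d n \<and> ?d n \<le> ?e 1 n * ?e j n / real (Suc (Suc n div 2))" for n
    proof -
      have N: "1 \<le> Suc (Suc n div 2)" "Suc (Suc n div 2) \<le> Suc n \<or> n = 0" by linarith+
      show ?thesis
      proof (cases "n = 0")
        case False
        then show ?thesis using harmonic_esym_newton[OF N(1), of "Suc n" "Suc j"]
          harmonic_esym_newton[OF N(1), of "Suc n" j] N by simp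
      qed simp
    qed
    have inv: "(\<lambda>n. 1 / real (Suc (Suc n div 2))) \<longlonglongrightarrow> 0"
      by (rule filterlim_compose[OF LIMSEQ_Suc[OF lim_1_over_n] half_at_top])
    have "?d \<longlonglongrightarrow> 0"
    proof (rule tendsto_sandwich[OF _ _ tendsto_const])
      show "(\<lambda>n. ?e 1 n * ?e j n / real (Suc (Suc n div 2))) \<longlonglongrightarrow> 0"
        using tendsto_mult[OF tendsto_mult[OF e1 ej] inv] by simp
    qed (use newton in auto)
    from tendsto_divide[OF tendsto_diff[OF tendsto_mult[OF e1 ej'] this] tendsto_const[of "real (Suc (Suc j))"]]
    have "?e k \<longlonglongrightarrow> (ln 2 * (ln 2 ^ Suc j / fact (Suc j)) - 0) / real (Suc (Suc j))"
      using 3 by (simp del: of_nat_Suc fact_Suc)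
    also have "(ln 2 * (ln 2 ^ Suc j / fact (Suc j)) - 0) / real (Suc (Suc j)) = (ln 2 ^ k / fact k :: real)"
      unfolding 3 fact_Suc[of "Suc j"] by (simp del: of_nat_Suc fact_Suc)
    finally show ?thesis .
  qed (use e1 in simp_all)
qed

text \<open>
  Euler's limit formula for the Gamma function gives \<open>growth \<alpha> (m + 1)\<close> as \<open>m powr (\<alpha> - 1)\<close> times a
  factor with a nonzero limit, which cancels in the ratio.
\<close>

lemma growth_ratio_tendsto:
  fixes \<alpha> :: real
  assumes a: "\<alpha> > 0"
  shows "(\<lambda>n. growth \<alpha> (Suc (Suc n div 2)) / growth \<alpha> (Suc n)) \<longlonglongrightarrow> 2 powr (1 - \<alpha>)"
proof -
  \<comment> \<open>the last factor tends to 1 and removes the factor \<open>\<alpha> + m\<close> by which the Gamma series is longer than \<open>growth\<close>\<close>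
  define f where "f m = rGamma_series \<alpha> m * (1 / (\<alpha> * (1 / real m) + 1))" for m
  have rG: "rGamma \<alpha> \<noteq> 0" using a by (simp add: rGamma_eq_zero_iff) (auto elim!: nonpos_Ints_cases)
  have "f \<longlonglongrightarrow> rGamma \<alpha> * (1 / (\<alpha> * 0 + 1))"
    unfolding f_def by (intro tendsto_intros lim_1_over_n rGamma_series_LIMSEQ) simp_all
  then have f: "f \<longlonglongrightarrow> rGamma \<alpha>" by simp
  have f_eq: "growth \<alpha> (Suc m) = f m * real m powr (\<alpha> - 1)" if "m > 0" for m
  proof -
    define P where "P = real m powr (\<alpha> - 1)"
    have P: "P > 0" using that by (simp add: P_def)
    have "P = exp (\<alpha> * ln (real m)) / real m"
      using that by (simp add: P_def powr_def left_diff_distrib exp_diff)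
    then have exp_eq: "exp (\<alpha> * ln (real m)) = real m * P" using that by simp
    have "1 / (\<alpha> * (1 / real m) + 1) = real m / (\<alpha> + real m)" using that by (simp add: field_simps)
    moreover have "\<alpha> + real m > 0" using a by simp
    ultimately show ?thesis using that P
      by (simp add: growth_def f_def rGamma_series_def pochhammer_Suc exp_eq P_def[symmetric])
  qed
  have "(\<lambda>n. f (Suc n div 2) / f n * (real (Suc n div 2) / real n) powr (\<alpha> - 1)) \<longlonglongrightarrow>
      rGamma \<alpha> / rGamma \<alpha> * (1 / 2) powr (\<alpha> - 1)"
    by (intro tendsto_mult tendsto_divide filterlim_compose[OF f half_at_top] f rG
        tendsto_powr half_ratio_tendsto tendsto_const) simp
  also have "rGamma \<alpha> / rGamma \<alpha> * (1 / 2) powr (\<alpha> - 1) = 2 powr (1 - \<alpha>)"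
    using rG by (simp add: powr_divide powr_diff field_simps)
  finally show ?thesis
  proof (rule Lim_transform_eventually)
    show "\<forall>\<^sub>F n in sequentially. f (Suc n div 2) / f n * (real (Suc n div 2) / real n) powr (\<alpha> - 1) =
        growth \<alpha> (Suc (Suc n div 2)) / growth \<alpha> (Suc n)"
      using eventually_gt_at_top[of 0]
    proof eventually_elim
      case (elim n)
      then have "Suc n div 2 > 0" by linarith
      then show ?case using elim by (simp add: f_eq powr_divide)
    qed
  qed
qed

section \<open>Convergence of the distribution and of the moments\<close>

lemma expectation_random_tree:
  fixes f :: "plane_tree \<Rightarrow> real"
  assumes "very_simple c1 c2"
  shows "measure_pmf.expectation (random_tree c1 c2 n) f = tree_avg c1 c2 n f"
proof -
  have "measure_pmf.expectation (random_tree c1 c2 n) f =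
      (\<Sum>T\<in>plane_increasing_trees n. f T * pmf (random_tree c1 c2 n) T)"
    by (rule integral_measure_pmf_real[OF finite_plane_increasing_trees])
      (auto simp: set_pmf_iff pmf_random_tree[OF assms] split: if_splits)
  then show ?thesis
    by (simp add: pmf_random_tree[OF assms] tree_avg_def sum_divide_distrib mult.commute)
qed

lemma pmf_centroid_depth:
  assumes vs: "very_simple c1 c2"
  shows "pmf (map_pmf (centroid_depth n) (random_tree c1 c2 n)) h = depth_tail c1 c2 n h - depth_tail c1 c2 n (Suc h)"
proof -
  have "pmf (map_pmf (centroid_depth n) (random_tree c1 c2 n)) h =
      measure_pmf.expectation (random_tree c1 c2 n) (indicator (centroid_depth n -` {h}))"
    by (simp add: pmf_map)
  also have "\<dots> = tree_avg c1 c2 n (indicator (centroid_depth n -` {h}))"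
    by (rule expectation_random_tree[OF vs])
  also have "\<dots> = tree_avg c1 c2 n (\<lambda>T. of_bool (h \<le> centroid_depth n T) + (- 1) * of_bool (Suc h \<le> centroid_depth n T))"
    by (rule tree_avg_cong) (auto simp: indicator_def)
  also have "\<dots> = depth_tail c1 c2 n h - depth_tail c1 c2 n (Suc h)"
    unfolding tree_avg_add tree_avg_cmult by (simp add: depth_tail_def)
  finally show ?thesis .
qed

lemma depth_tail_tendsto:
  assumes vs: "very_simple c1 c2"
  defines "\<alpha> \<equiv> tree_alpha c1 c2"
  assumes a: "\<alpha> \<noteq> 1"
  shows "(\<lambda>n. depth_tail c1 c2 (Suc n) h) \<longlonglongrightarrow>
    (\<alpha> / (\<alpha> - 1)) ^ h * (1 - 2 powr (1 - \<alpha>) * (\<Sum>j<h. ((\<alpha> - 1) * ln 2) ^ j / fact j))"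
proof (induction h)
  case 0
  then show ?case by (simp add: depth_tail_0[OF vs])
next
  case (Suc h)
  have pos: "\<alpha> > 0" using vs by (simp add: very_simple_def \<alpha>_def)
  let ?N = "\<lambda>n. Suc (Suc n div 2)"
  let ?S = "\<Sum>j<h. ((\<alpha> - 1) * ln 2) ^ j / fact j"
  let ?r = "2 powr (1 - \<alpha>)"
  define b where "b = \<alpha> - 1"
  have b: "b \<noteq> 0" using a by (simp add: b_def)
  have "depth_tail c1 c2 (Suc n) (Suc h) = (\<alpha> * depth_tail c1 c2 (Suc n) h -
      \<alpha> ^ Suc h * (growth \<alpha> (?N n) / growth \<alpha> (Suc n)) * harmonic_esym (?N n) (Suc n) h) / b" for n
    using depth_tail_recursion[OF vs, of "Suc n" h] b by (simp add: \<alpha>_def[symmetric] b_def[symmetric] field_simps)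
  moreover have "(\<lambda>n. (\<alpha> * depth_tail c1 c2 (Suc n) h -
      \<alpha> ^ Suc h * (growth \<alpha> (?N n) / growth \<alpha> (Suc n)) * harmonic_esym (?N n) (Suc n) h) / b) \<longlonglongrightarrow>
      (\<alpha> * ((\<alpha> / b) ^ h * (1 - ?r * ?S)) - \<alpha> ^ Suc h * ?r * (ln 2 ^ h / fact h)) / b"
    using Suc.IH b unfolding b_def[symmetric]
    by (intro tendsto_intros growth_ratio_tendsto[OF pos] harmonic_esym_tendsto) auto
  moreover have "(\<alpha> * ((\<alpha> / b) ^ h * (1 - ?r * ?S)) - \<alpha> ^ Suc h * ?r * (ln 2 ^ h / fact h)) / b =
      (\<alpha> / b) ^ Suc h * (1 - ?r * (?S + (b * ln 2) ^ h / fact h))"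
    using b by (simp add: field_simps power_divide power_mult_distrib)
  ultimately show ?case unfolding sum.lessThan_Suc b_def[symmetric] by (simp only:)
qed

text \<open>
  By the recursion, the difference of two consecutive tails is
  \<open>\<alpha> ^ (h + 1) * (g N / g n) * e h - Q h\<close> divided by \<open>\<alpha> - 1\<close>. For \<open>\<alpha> = 1\<close> the recursion gives
  the tails themselves.
\<close>

lemma pmf_centroid_depth_tendsto:
  assumes vs: "very_simple c1 c2"
  shows "(\<lambda>n. depth_tail c1 c2 (Suc n) h - depth_tail c1 c2 (Suc n) (Suc h)) \<longlonglongrightarrow> limit_prob (tree_alpha c1 c2) h"
proof -
  define \<alpha> where "\<alpha> = tree_alpha c1 c2"
  have pos: "\<alpha> > 0" using vs by (simp add: very_simple_def \<alpha>_def)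
  let ?N = "\<lambda>n. Suc (Suc n div 2)"
  let ?R = "\<lambda>h n. \<alpha> ^ Suc h * (growth \<alpha> (?N n) / growth \<alpha> (Suc n)) * harmonic_esym (?N n) (Suc n) h"
  have R: "?R h \<longlonglongrightarrow> \<alpha> ^ Suc h * 2 powr (1 - \<alpha>) * (ln 2 ^ h / fact h)" for h
    by (intro tendsto_intros growth_ratio_tendsto[OF pos] harmonic_esym_tendsto)
  have rec: "\<alpha> * depth_tail c1 c2 (Suc n) h - (\<alpha> - 1) * depth_tail c1 c2 (Suc n) (Suc h) = ?R h n" for n h
    using depth_tail_recursion[OF vs, of "Suc n" h] by (simp add: \<alpha>_def)
  show ?thesis unfolding \<alpha>_def[symmetric]
  proof (cases "\<alpha> = 1")
    case True
    have "depth_tail c1 c2 (Suc n) h = ?R h n" for n h using rec[of n h] True by simp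
    then show "(\<lambda>n. depth_tail c1 c2 (Suc n) h - depth_tail c1 c2 (Suc n) (Suc h)) \<longlonglongrightarrow> limit_prob \<alpha> h"
      using tendsto_diff[OF R[of h] R[of "Suc h"]] True
      by (simp add: limit_prob_def del: fact_Suc)
  next
    case False
    define b where "b = \<alpha> - 1"
    have b: "b \<noteq> 0" using False by (simp add: b_def)
    let ?S = "\<Sum>j<h. ((\<alpha> - 1) * ln 2) ^ j / fact j"
    let ?r = "2 powr (1 - \<alpha>)"
    have "depth_tail c1 c2 (Suc n) h - depth_tail c1 c2 (Suc n) (Suc h) = (?R h n - depth_tail c1 c2 (Suc n) h) / b" for n
      using rec[of n h, symmetric] b by (simp add: b_def field_simps)
    moreover have "(\<lambda>n. (?R h n - depth_tail c1 c2 (Suc n) h) / b) \<longlonglongrightarrow>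
        (\<alpha> ^ Suc h * ?r * (ln 2 ^ h / fact h) - (\<alpha> / b) ^ h * (1 - ?r * ?S)) / b"
      using depth_tail_tendsto[OF vs, of h] False b
      by (intro tendsto_divide tendsto_diff R tendsto_const) (simp_all add: \<alpha>_def b_def)
    moreover have "(\<alpha> ^ Suc h * ?r * (ln 2 ^ h / fact h) - (\<alpha> / b) ^ h * (1 - ?r * ?S)) / b = limit_prob \<alpha> h"
      using False b unfolding limit_prob_def b_def[symmetric]
      by (simp add: field_simps power_divide power_mult_distrib)
    ultimately show "(\<lambda>n. depth_tail c1 c2 (Suc n) h - depth_tail c1 c2 (Suc n) (Suc h)) \<longlonglongrightarrow> limit_prob \<alpha> h" by simp
  qed
qed

text \<open>
  The constant comes from the limit of the ratio of the growth factors; the factorial comes from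
  \<open>harmonic_esym_le\<close>, in which the sum of the variables tends to \<open>ln 2 < 1\<close>.
\<close>

lemma eventually_depth_tail_le:
  assumes vs: "very_simple c1 c2"
  defines "\<alpha> \<equiv> tree_alpha c1 c2"
  shows "\<exists>C. \<forall>\<^sub>F n in sequentially. \<forall>h. depth_tail c1 c2 (Suc n) h \<le> C * (\<alpha> ^ h / fact h)"
proof -
  have pos: "\<alpha> > 0" using vs by (simp add: very_simple_def \<alpha>_def)
  let ?N = "\<lambda>n. Suc (Suc n div 2)"
  define r where "r = (2::real) powr (1 - \<alpha>) + 1"
  have "\<forall>\<^sub>F n in sequentially. growth \<alpha> (?N n) / growth \<alpha> (Suc n) < r"
    using growth_ratio_tendsto[OF pos] by (rule order_tendstoD) (simp add: r_def)
  moreover have "\<forall>\<^sub>F n in sequentially. harmonic_esym (?N n) (Suc n) 1 < 1"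
    using harmonic_esym_1_tendsto ln_2_less_1 by (rule order_tendstoD)
  ultimately have "\<forall>\<^sub>F n in sequentially. \<forall>h. depth_tail c1 c2 (Suc n) h \<le> max 1 \<alpha> * r * (\<alpha> ^ h / fact h)"
    using eventually_gt_at_top[of 0]
  proof eventually_elim
    case (elim n)
    have N: "1 \<le> ?N n" "?N n \<le> Suc n" using elim(3) by linarith+
    show ?case
    proof
      fix h
      let ?e = "harmonic_esym (?N n) (Suc n)"
      have e1: "0 \<le> ?e 1" by (rule harmonic_esym_nonneg[OF N(2)])
      have "?e h \<le> ?e 1 ^ h / fact h" by (rule harmonic_esym_le[OF N])
      also have "\<dots> \<le> 1 / fact h"
        using e1 elim(2) by (intro divide_right_mono power_le_one) auto
      finally have e: "?e h \<le> 1 / fact h" .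
      have "depth_tail c1 c2 (Suc n) h \<le> max 1 \<alpha> * (\<alpha> ^ h * (growth \<alpha> (?N n) / growth \<alpha> (Suc n)) * ?e h)"
        using depth_tail_bound[OF vs, of "Suc n" h] by (simp add: \<alpha>_def)
      also have "\<dots> \<le> max 1 \<alpha> * (\<alpha> ^ h * r * (1 / fact h))"
        using elim(1) e pos growth_pos[OF pos] harmonic_esym_nonneg[OF N(2), of h]
        by (intro mult_left_mono mult_mono) (auto simp: r_def less_imp_le intro!: mult_nonneg_nonneg)
      finally show "depth_tail c1 c2 (Suc n) h \<le> max 1 \<alpha> * r * (\<alpha> ^ h / fact h)" by (simp add: mult_ac)
    qed
  qed
  then show ?thesis by blast
qed

lemma expectation_nat_pmf:
  fixes p :: "nat pmf" and f :: "nat \<Rightarrow> real"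
  assumes "summable (\<lambda>h. norm (pmf p h * f h))"
  shows "measure_pmf.expectation p f = (\<Sum>h. pmf p h * f h)"
proof -
  have "measure_pmf.expectation p f = integral\<^sup>L (count_space UNIV) (\<lambda>h. pmf p h *\<^sub>R f h)"
    unfolding measure_pmf_eq_density by (rule integral_density) auto
  also have "\<dots> = (\<Sum>h. pmf p h * f h)"
    using assms by (simp add: integral_count_space_nat integrable_count_space_nat_iff)
  finally show ?thesis .
qed

lemma power_le_fact_exp: "real h ^ m \<le> fact m * exp 1 ^ h"
proof -
  have "real h ^ m / fact m \<le> exp (real h)"
    using sum_le_suminf[OF summable_exp_generic[of "real h"], of "{m}"]
    by (simp add: exp_def divide_inverse mult.commute)
  then show ?thesis by (simp add: divide_le_eq mult.commute exp_of_nat_mult[of h 1, simplified])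
qed

text \<open>
  The bound on the probabilities beats every power of \<open>h\<close>, so limit and summation may be
  interchanged by Tannery's theorem.
\<close>

lemma moments_tendsto:
  fixes p :: "nat \<Rightarrow> nat pmf" and q :: "nat pmf" and C x :: real
  assumes lim: "\<And>h. (\<lambda>n. pmf (p n) h) \<longlonglongrightarrow> pmf q h"
    and bound: "\<forall>\<^sub>F n in sequentially. \<forall>h. pmf (p n) h \<le> C * (x ^ h / fact h)" and x: "x \<ge> 0"
  shows "(\<lambda>n. measure_pmf.expectation (p n) (\<lambda>h. real h ^ m)) \<longlonglongrightarrow>
    measure_pmf.expectation q (\<lambda>h. real h ^ m)"
proof -
  define M where "M h = C * fact m * ((exp 1 * x) ^ h / fact h)" for h
  let ?a = "\<lambda>h n. pmf (p n) h * real h ^ m"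
  let ?b = "\<lambda>h. pmf q h * real h ^ m"
  have M: "summable M"
    unfolding M_def using summable_exp_generic[of "exp 1 * x"]
    by (intro summable_mult) (simp add: divide_inverse mult.commute)
  have ev: "\<forall>\<^sub>F n in sequentially. \<forall>h. norm (?a h n) \<le> M h"
    using bound
  proof eventually_elim
    case (elim n)
    show ?case
    proof
      fix h
      have "?a h n \<le> (C * (x ^ h / fact h)) * (fact m * exp 1 ^ h)"
        using elim order_trans[OF pmf_nonneg elim[rule_format, of h]] by (intro mult_mono power_le_fact_exp) auto
      then show "norm (?a h n) \<le> M h" by (simp add: M_def power_mult_distrib mult_ac)
    qed
  qed
  have "\<forall>\<^sub>F (h, n) in at_top \<times>\<^sub>F sequentially. norm (?a h n) \<le> M h"
    unfolding eventually_prod_filter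
    by (rule exI[of _ "\<lambda>_. True"], rule exI[of _ "\<lambda>n. \<forall>h. norm (?a h n) \<le> M h"]) (use ev in simp)
  from tannerys_theorem[OF tendsto_mult_right[OF lim] this M]
  have conv: "\<forall>\<^sub>F n in sequentially. summable (\<lambda>h. norm (?a h n))" "summable (\<lambda>h. norm (?b h))"
    "(\<lambda>n. \<Sum>h. ?a h n) \<longlonglongrightarrow> (\<Sum>h. ?b h)" by simp_all
  have "\<forall>\<^sub>F n in sequentially. (\<Sum>h. ?a h n) = measure_pmf.expectation (p n) (\<lambda>h. real h ^ m)"
    using conv(1) by eventually_elim (rule expectation_nat_pmf[symmetric])
  from Lim_transform_eventually[OF conv(3) this] show ?thesis
    by (simp only: expectation_nat_pmf[OF conv(2)])
qed

theorem lemma8: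
  fixes c1 c2 :: real and m :: nat
  assumes "very_simple c1 c2" and "m \<ge> 1"
  shows "(\<lambda>n. measure_pmf.expectation (random_tree c1 c2 n) (\<lambda>T. real (centroid_depth n T) ^ m))
           \<longlonglongrightarrow> measure_pmf.expectation (limit_depth (tree_alpha c1 c2)) (\<lambda>h. real h ^ m)"
proof -
  note vs = assms(1)
  let ?p = "\<lambda>n. map_pmf (centroid_depth n) (random_tree c1 c2 n)"
  obtain C where C: "\<forall>\<^sub>F n in sequentially. \<forall>h. depth_tail c1 c2 (Suc n) h \<le> C * (tree_alpha c1 c2 ^ h / fact h)"
    using eventually_depth_tail_le[OF vs] by blast
  have "(\<lambda>n. measure_pmf.expectation (?p (Suc n)) (\<lambda>h. real h ^ m)) \<longlonglongrightarrow>
      measure_pmf.expectation (limit_depth (tree_alpha c1 c2)) (\<lambda>h. real h ^ m)"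
  proof (rule moments_tendsto)
    show "(\<lambda>n. pmf (?p (Suc n)) h) \<longlonglongrightarrow> pmf (limit_depth (tree_alpha c1 c2)) h" for h
      unfolding pmf_centroid_depth[OF vs] pmf_limit_depth[OF vs] by (rule pmf_centroid_depth_tendsto[OF vs])
    show "\<forall>\<^sub>F n in sequentially. \<forall>h. pmf (?p (Suc n)) h \<le> C * (tree_alpha c1 c2 ^ h / fact h)"
      using C
    proof eventually_elim
      case (elim n)
      show ?case unfolding pmf_centroid_depth[OF vs]
        using elim depth_tail_nonneg[OF vs] by (smt (verit))
    qed
    show "tree_alpha c1 c2 \<ge> 0" using vs by (simp add: very_simple_def)
  qed
  then show ?thesis unfolding integral_map_pmf by (rule LIMSEQ_imp_Suc)
qed

end
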